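(* Let $\{X_i\}_{i=1}^\infty$ be an i.i.d. sequence of random variables under a sublinear expectation $\mathbb{E}[\cdot]=\sup_{\theta\in\Theta}E_\theta[\cdot]$. Suppose that $\mathbb{E}[X_1^2]<\infty$. Denote $\overline{\mu}:=\mathbb{E}[X_1]$ and $\underline{\mu}:=-\mathbb{E}[-X_1]$. Then, for every differentiable $\varphi:\mathbb{R}\to\mathbb{R}$ such that $\varphi'$ is Lipschitz, and every $n\ge1$, $$\Big|\mathbb{E}\Big\{\varphi\Big[\frac{\sum_{i=1}^n(X_i-\mu_i)}{n}\Big]\Big\}-\varphi(0)\Big|\le\frac{C_0\|\varphi''\|}{n},$$ where $\mu_i$ is defined recursively for $i=1,\dots,n$ by $$\mu_i=\begin{cases}\overline{\mu},&\text{if }\varphi'\big[\frac{\sum_{j=1}^{i-1}(X_j-\mu_j)}{n}\big]\ge0,\\ \underline{\mu},&\text{if }\varphi'\big[\frac{\sum_{j=1}^{i-1}(X_j-\mu_j)}{n}\big]<0,\end{cases}$$ and $$C_0=\frac12\big[\overline{\sigma}^2+(\overline{\mu}-\underline{\mu})^2\big],\qquad\overline{\sigma}^2=\sup_{\theta\in\Theta}E_\theta\Big\{\big[X_1-E_\theta(X_1)\big]^2\Big\}.$$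
   Context: Let $\{P_\theta:\theta\in\Theta\}$ be a set of probability measures on a measurable space $(\Omega,\mathcal{F})$, and let $E_\theta$ be the expectation under $P_\theta$. For a random variable $X$ such that $E_\theta[X]$ exists for all $\theta\in\Theta$, the sublinear expectation is $\mathbb{E}[X]:=\sup_{\theta\in\Theta}E_\theta[X]$. Two random variables $X,Y$ are identically distributed if $\mathbb{E}[\varphi(X)]=\mathbb{E}[\varphi(Y)]$ for all bounded continuous $\varphi$. A random vector $Y\in\mathbb{R}^n$ is independent of a random vector $X\in\mathbb{R}^m$ if $\mathbb{E}[\varphi(X,Y)]=\mathbb{E}\big\{\{\mathbb{E}[\varphi(x,Y)]\}_{x=X}\big\}$ for all bounded continuous $\varphi:\mathbb{R}^{m+n}\to\mathbb{R}$ (this relation is not symmetric). A sequence $\{X_i\}_{i=1}^\infty$ is i.i.d. if for each $i\ge1$, $X_{i+1}$ is identically distributed as $X_1$ and independent of $(X_1,\dots,X_i)$. $\|\cdot\|$ denotes the supremum norm of a function ($\varphi''$ exists almost everywhere, and $\|\varphi''\|$ is the Lipschitz constant of $\varphi'$). Empty sums are $0$. *)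

theory Defs
  imports "HOL-Probability.Probability"
begin

text \<open>
  Both the Bochner integral and the supremum over \<open>real\<close> are total. The value below is the
  sublinear expectation when \<open>\<Theta>\<close> is nonempty, \<open>Z\<close> is integrable under every \<open>P \<theta>\<close> and the
  expectations are bounded above in \<open>\<theta>\<close>; otherwise it carries no meaning.
\<close>

definition sublinear_expectation :: "('t \<Rightarrow> 'a measure) \<Rightarrow> 't set \<Rightarrow> ('a \<Rightarrow> real) \<Rightarrow> real"
  where "sublinear_expectation P \<Theta> Z = (SUP \<theta>\<in>\<Theta>. \<integral>\<omega>. Z \<omega> \<partial>P \<theta>)"

definition identically_distributed ::
    "('t \<Rightarrow> 'a measure) \<Rightarrow> 't set \<Rightarrow> ('a \<Rightarrow> real) \<Rightarrow> ('a \<Rightarrow> real) \<Rightarrow> bool"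
  where "identically_distributed P \<Theta> Y Z \<longleftrightarrow>
    (\<forall>f :: real \<Rightarrow> real. continuous_on UNIV f \<and> bounded (range f) \<longrightarrow>
      sublinear_expectation P \<Theta> (\<lambda>\<omega>. f (Y \<omega>)) = sublinear_expectation P \<Theta> (\<lambda>\<omega>. f (Z \<omega>)))"

text \<open>
  \<open>Y\<close> is independent of \<open>Z\<close>; the relation is not symmetric. The topologies \<open>T\<close> and \<open>U\<close> are those
  of the spaces in which \<open>Z\<close> and \<open>Y\<close> take their values, so that vectors of any length are covered:
  \<open>\<real>\<^sup>m\<close> is \<open>powertop_real {1..m}\<close>, and \<open>\<real>\<^sup>m\<^sup>+\<^sup>n\<close> is read as the product of \<open>\<real>\<^sup>m\<close> and \<open>\<real>\<^sup>n\<close>.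
\<close>

definition independent_of ::
    "('t \<Rightarrow> 'a measure) \<Rightarrow> 't set \<Rightarrow> 'c topology \<Rightarrow> ('a \<Rightarrow> 'c) \<Rightarrow> 'b topology \<Rightarrow> ('a \<Rightarrow> 'b) \<Rightarrow> bool"
  where "independent_of P \<Theta> U Y T Z \<longleftrightarrow>
    (\<forall>f :: 'b \<times> 'c \<Rightarrow> real.
      continuous_map (prod_topology T U) euclideanreal f \<and>
      bounded (f ` topspace (prod_topology T U)) \<longrightarrow>
      sublinear_expectation P \<Theta> (\<lambda>\<omega>. f (Z \<omega>, Y \<omega>)) =
      sublinear_expectation P \<Theta> (\<lambda>\<omega>. sublinear_expectation P \<Theta> (\<lambda>\<omega>'. f (Z \<omega>, Y \<omega>'))))"

text \<open>The sequence is \<open>X 1, X 2, \<dots>\<close>; the value \<open>X 0\<close> plays no role.\<close>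

definition iid_sequence ::
    "('t \<Rightarrow> 'a measure) \<Rightarrow> 't set \<Rightarrow> (nat \<Rightarrow> 'a \<Rightarrow> real) \<Rightarrow> bool"
  where "iid_sequence P \<Theta> X \<longleftrightarrow>
    (\<forall>i\<ge>1. identically_distributed P \<Theta> (X (i + 1)) (X 1) \<and>
      independent_of P \<Theta> euclideanreal (X (i + 1))
        (powertop_real {1..i}) (\<lambda>\<omega>. \<lambda>j\<in>{1..i}. X j \<omega>))"

definition lipschitz_constant :: "(real \<Rightarrow> real) \<Rightarrow> real"
  where "lipschitz_constant g = Inf {L. L-lipschitz_on UNIV g}"

text \<open>
  \<open>centering d a b n x i\<close> is \<open>\<mu>\<^sub>i\<close> along the path \<open>x\<close>, where \<open>d\<close> is the derivative of the test
  function and \<open>a\<close>, \<open>b\<close> are the upper and lower means. The congruence rule shows termination: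
  only \<open>\<mu>\<^sub>j\<close> with \<open>j < i\<close> occur in the sum.
\<close>

context
  notes sum.cong [fundef_cong]
begin

fun centering :: "(real \<Rightarrow> real) \<Rightarrow> real \<Rightarrow> real \<Rightarrow> nat \<Rightarrow> (nat \<Rightarrow> real) \<Rightarrow> nat \<Rightarrow> real"
  where "centering d a b n x i =
    (if d ((\<Sum>j\<in>{1..<i}. x j - centering d a b n x j) / real n) \<ge> 0 then a else b)"

end

declare centering.simps [simp del]

end

theory Submission
  imports Defs
begin

text \<open>
  Write \<open>W\<^sub>i\<close> for the partial sums of the \<open>(X\<^sub>j - \<mu>\<^sub>j) / n\<close>. A second order Taylor expansion along
  \<open>W\<^sub>0, \<dots>, W\<^sub>n\<close> leaves remainders of total size at most \<open>C\<^sub>0 \<parallel>\<phi>''\<parallel> / n\<close> under every \<open>P \<theta>\<close>, and the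
  drift terms \<open>E\<^sub>\<theta> [\<phi>' W\<^sub>i\<^sub>-\<^sub>1 (X\<^sub>i - \<mu>\<^sub>i)]\<close> are nonpositive by the choice of \<open>\<mu>\<^sub>i\<close>. The lower bound
  needs one \<open>\<theta>\<close> for which all \<open>n\<close> drift terms are nearly \<open>0\<close>. Independence speaks only about
  continuous functions of the past, while \<open>\<mu>\<^sub>i\<close> jumps where \<open>\<phi>' W\<^sub>i\<^sub>-\<^sub>1 = 0\<close>. The remedy is to maximise
  \<open>\<Sum>\<^sub>i \<rho>\<^sup>i (drift\<^sub>i + \<epsilon> 1[\<phi>' W\<^sub>i\<^sub>-\<^sub>1 < 0])\<close> with a small \<open>\<rho>\<close>: the bonus makes this functional a limit from
  below of continuous ones, so that independence applies to it, and the rapidly decreasing weights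
  force a near maximiser to be nearly optimal at each step.
\<close>

subsection \<open>Functions with Lipschitz derivative and truncation\<close>

text \<open>The family of measures is not assumed to be closed under pasting, so a good \<theta>
  cannot be assembled from optimisers of the single steps. Independence only gives equations between
  suprema; hence one functional that sees all steps has to be nearly maximised. At a zero of
  \<open>\<phi>'\<close> the jump of the centering does not affect the current drift, whose factor
  vanishes there, but it shifts the whole later path. If the later terms are bounded by
  \<open>J + \<epsilon>\<close> before weighting, two continuations differ, relative to the current
  weight, by at most \<open>2 * (J + \<epsilon>) * \<rho> / (1 - \<rho>)\<close>. This is at most
  \<open>\<epsilon>\<close> exactly when
  \<open>\<rho> * (2 * J + 3 * \<epsilon>) \<le> \<epsilon>\<close>, the condition that recurs
  below. It presupposes bounded gains, so \<open>\<phi>'\<close> and the observations are truncated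
  first; the truncation is removed at the end with second moments that are bounded uniformly in
  \<theta>.\<close>

lemma lipschitz_on_lipschitz_constant:
  assumes "\<exists>L. L-lipschitz_on UNIV g"
  shows "(lipschitz_constant g)-lipschitz_on UNIV g"
proof (rule lipschitz_onI)
  let ?S = "{L. L-lipschitz_on UNIV g}"
  have ne: "?S \<noteq> {}" using assms by auto
  show "0 \<le> lipschitz_constant g"
    unfolding lipschitz_constant_def using ne
    by (intro cInf_greatest) (auto dest: lipschitz_on_nonneg)
  fix x y :: real
  show "dist (g x) (g y) \<le> lipschitz_constant g * dist x y"
  proof (cases "x = y")
    case False
    \<comment> \<open>The infimum is attained because, for distinct points, the difference quotient
      is a lower bound of all admissible constants.\<close>
    have "dist (g x) (g y) / dist x y \<le> lipschitz_constant g"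
      unfolding lipschitz_constant_def
    proof (rule cInf_greatest[OF ne])
      fix L assume "L \<in> ?S"
      then have "dist (g x) (g y) \<le> L * dist x y" by (auto dest: lipschitz_onD)
      then show "dist (g x) (g y) / dist x y \<le> L" using False by (simp add: divide_le_eq)
    qed
    then show ?thesis using False by (simp add: divide_le_eq)
  qed simp
qed

text \<open>A second derivative need not exist everywhere. Instead, the error minus
  \<open>L / 2 * h\<^sup>2\<close> is nonincreasing in the distance \<open>h\<close> from
  \<open>x\<close>, since its derivative is an increment of \<open>deriv f\<close> over that
  distance minus \<open>L * h\<close>.\<close>

lemma taylor_bound_lipschitz_deriv:
  fixes f :: "real \<Rightarrow> real"
  assumes diff: "\<And>x. f differentiable (at x)" and lip: "L-lipschitz_on UNIV (deriv f)"
  shows "\<bar>f y - f x - deriv f x * (y - x)\<bar> \<le> L / 2 * (y - x)\<^sup>2"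
proof -
  have fd: "(f has_real_derivative deriv f z) (at z)" for z
    using diff[of z] DERIV_deriv_iff_real_differentiable by blast
  have lipd: "\<bar>deriv f u - deriv f v\<bar> \<le> L * \<bar>u - v\<bar>" for u v
    using lipschitz_onD[OF lip, of u v] by (simp add: dist_real_def)
  \<comment> \<open>\<open>r\<close> is the direction of the displacement and \<open>s\<close> the
    sign of the error; one monotonicity argument covers all four cases.\<close>
  have main: "s * (f (x + r * h) - f x - deriv f x * (r * h)) \<le> L / 2 * h\<^sup>2"
    if "h \<ge> 0" "r = 1 \<or> r = -1" "s = 1 \<or> s = -1" for h r s :: real
  proof -
    let ?g = "\<lambda>u. s * (f (x + r * u) - f x - deriv f x * (r * u)) - L / 2 * u\<^sup>2"
    have "?g h \<le> ?g 0"
    proof (rule DERIV_nonpos_imp_nonincreasing[OF that(1)])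
      fix u :: real assume u: "0 \<le> u" "u \<le> h"
      have "(?g has_real_derivative s * (deriv f (x + r * u) * r - deriv f x * r) - L * u) (at u)"
        by (auto intro!: derivative_eq_intros DERIV_chain'[OF _ fd] simp: algebra_simps)
      moreover have "s * (deriv f (x + r * u) * r - deriv f x * r) - L * u \<le> 0"
        using lipd[of "x + r * u" x] that(2,3) u by (auto simp: abs_mult abs_le_iff)
      ultimately show "\<exists>D. (?g has_real_derivative D) (at u) \<and> D \<le> 0" by blast
    qed
    then show ?thesis by simp
  qed
  obtain h r :: real where "h \<ge> 0" "r = 1 \<or> r = -1" "y = x + r * h"
  proof (cases "y \<ge> x")
    case True then show ?thesis using that[of "y - x" 1] by simp
  next
    case False then show ?thesis using that[of "x - y" "-1"] by simp
  qed
  then have "(y - x)\<^sup>2 = h\<^sup>2" "y - x = r * h" by auto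
  then show ?thesis
    using main[of h r 1] main[of h r "-1"] \<open>h \<ge> 0\<close> \<open>r = 1 \<or> r = -1\<close> \<open>y = x + r * h\<close>
    by (simp only: abs_le_iff) simp
qed

lemma sum_square_le: "(x + y)\<^sup>2 \<le> 2 * x\<^sup>2 + 2 * y\<^sup>2" for x y :: real
  using sum_squares_bound[of x y] by (simp add: power2_sum)

definition clip :: "real \<Rightarrow> real \<Rightarrow> real"
  where "clip R x = max (- R) (min R x)"

lemma clip_bound: "0 \<le> R \<Longrightarrow> \<bar>clip R x\<bar> \<le> R"
  by (auto simp: clip_def)

lemma continuous_clip: "continuous_on UNIV f \<Longrightarrow> continuous_on UNIV (\<lambda>x. clip R (f x))"
  unfolding clip_def by (intro continuous_intros)

text \<open>Beyond the level \<open>R\<close> the factor \<open>\<bar>x\<bar> / R\<close> exceeds 1.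
  A bound on second moments thus yields a truncation error of order \<open>1 / R\<close>, uniformly
  over all measures that share the bound.\<close>

lemma clip_error:
  assumes "0 < R"
  shows "\<bar>x - clip R x\<bar> \<le> x\<^sup>2 / R"
proof (cases "\<bar>x\<bar> \<le> R")
  case True
  then show ?thesis using assms by (auto simp: clip_def)
next
  case False
  have "\<bar>x\<bar> * R \<le> \<bar>x\<bar> * \<bar>x\<bar>" using False by (intro mult_left_mono) auto
  then have "\<bar>x\<bar> \<le> x\<^sup>2 / R" using assms by (simp add: le_divide_eq power2_eq_square)
  moreover have "\<bar>x - clip R x\<bar> \<le> \<bar>x\<bar>" using False assms by (auto simp: clip_def)
  ultimately show ?thesis by linarith
qed

subsection \<open>Paths with switched centering\<close>

lemma continuous_map_real_comp:
  assumes "continuous_on UNIV (f :: real \<Rightarrow> real)" "continuous_map T euclideanreal g"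
  shows "continuous_map T euclideanreal (\<lambda>z. f (g z))"
  using continuous_map_compose[of T euclidean g euclidean f] assms by (simp add: o_def)

locale switched_path =
  fixes dv :: "real \<Rightarrow> real" and a b \<nu> :: real
begin

definition target :: "real \<Rightarrow> real"
  where "target w = (if dv w \<ge> 0 then a else b)"

primrec state :: "(nat \<Rightarrow> real) \<Rightarrow> nat \<Rightarrow> real" where
  "state x 0 = 0"
| "state x (Suc m) = state x m + (x (Suc m) - target (state x m)) / \<nu>"

definition falling :: "real \<Rightarrow> real"
  where "falling w = (if dv w < 0 then 1 else 0)"

text \<open>For continuous \<open>dv\<close> the set where \<open>dv\<close> is negative is open, so
  its indicator is a limit of continuous functions from below. Every \<open>ramp k\<close> is 0
  wherever \<open>falling\<close> is 0, so the approximation errs on one side of the switch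
  only.\<close>

definition ramp :: "nat \<Rightarrow> real \<Rightarrow> real"
  where "ramp k w = min 1 (real k * max 0 (- dv w))"

text \<open>
  With \<open>\<gamma> = falling\<close> this is the sum of the running costs along the path that starts in \<open>w\<close> at
  time \<open>i\<close>, plus a terminal cost. A continuous \<open>\<gamma>\<close> mixes the two possible centerings and makes the
  dependence on \<open>x\<close> continuous.
\<close>

primrec blend :: "(nat \<Rightarrow> real \<Rightarrow> real \<Rightarrow> real) \<Rightarrow> (real \<Rightarrow> real) \<Rightarrow> (real \<Rightarrow> real) \<Rightarrow>
    nat \<Rightarrow> nat \<Rightarrow> real \<Rightarrow> (nat \<Rightarrow> real) \<Rightarrow> real" where
  "blend c \<tau> \<gamma> 0 i w x = \<tau> w"
| "blend c \<tau> \<gamma> (Suc r) i w x = c i w (x i) +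
    (\<gamma> w * blend c \<tau> \<gamma> r (Suc i) (w + (x i - b) / \<nu>) x +
     (1 - \<gamma> w) * blend c \<tau> \<gamma> r (Suc i) (w + (x i - a) / \<nu>) x)"

text \<open>The claims need a joint induction: the partial sum after \<open>m\<close> observations
  decides the centering of observation \<open>Suc m\<close>, which in turn enters the next partial
  sum.\<close>

lemma centering_eq_target:
  assumes "\<nu> = real n"
  shows "centering dv a b n x (Suc m) = target (state x m)"
    and "(\<Sum>j=1..m. x j - centering dv a b n x j) / real n = state x m"
proof -
  have "centering dv a b n x (Suc m) = target (state x m) \<and>
    (\<Sum>j=1..m. x j - centering dv a b n x j) / real n = state x m" (is "?P m")
  proof (induction m)
    case 0
    show ?case by (simp add: centering.simps[of _ _ _ _ _ "Suc 0"] target_def)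
  next
    case (Suc m)
    have "(\<Sum>j=1..Suc m. x j - centering dv a b n x j) / real n = state x (Suc m)"
      using Suc by (simp add: add_divide_distrib flip: assms)
    moreover have "{1..<Suc (Suc m)} = {1..Suc m}" by auto
    ultimately show ?case
      by (simp only: centering.simps[of _ _ _ _ _ "Suc (Suc m)"] target_def)
  qed
  then show "centering dv a b n x (Suc m) = target (state x m)"
    and "(\<Sum>j=1..m. x j - centering dv a b n x j) / real n = state x m" by auto
qed

lemma target_le: "\<bar>target w\<bar> \<le> \<bar>a\<bar> + \<bar>b\<bar>"
  by (auto simp: target_def)

lemma falling_bounds: "0 \<le> falling w" "falling w \<le> 1"
  by (auto simp: falling_def)

lemma ramp_bounds: "0 \<le> ramp k w" "ramp k w \<le> 1" "ramp k w \<le> falling w"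
  by (auto simp: ramp_def falling_def)

lemma ramp_tendsto: "(\<lambda>k. ramp k w) \<longlonglongrightarrow> falling w"
proof (cases "dv w < 0")
  case True
  obtain k0 where "1 / (- dv w) < real k0" using reals_Archimedean2 by blast
  then have "real k * (- dv w) \<ge> 1" if "k \<ge> k0" for k
  proof -
    have "1 / (- dv w) \<le> real k"
      using \<open>1 / (- dv w) < real k0\<close> that by (meson less_le_trans less_imp_le of_nat_mono)
    then show ?thesis using True pos_divide_le_eq[of "- dv w" 1 "real k"] by simp
  qed
  then have "eventually (\<lambda>k. real k * (- dv w) \<ge> 1) sequentially"
    by (auto simp: eventually_sequentially)
  then have "eventually (\<lambda>k. ramp k w = falling w) sequentially"
    by eventually_elim (use True in \<open>auto simp: ramp_def falling_def\<close>)
  then show ?thesis by (rule tendsto_eventually)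
next
  case False
  then show ?thesis by (simp add: ramp_def falling_def)
qed

lemma continuous_ramp: "continuous_on UNIV dv \<Longrightarrow> continuous_on UNIV (ramp k)"
  unfolding ramp_def by (intro continuous_intros)

section \<open>Algebra, bounds and limits of blends\<close>

lemma blend_cong:
  assumes "\<And>j. i \<le> j \<Longrightarrow> j < i + r \<Longrightarrow> x j = y j"
  shows "blend c \<tau> \<gamma> r i w x = blend c \<tau> \<gamma> r i w y"
  using assms by (induction r arbitrary: i w) auto

text \<open>The terminal cost enters linearly. This separates the factors that involve the next
  observation from what the past determines, as the application of independence requires.\<close>

lemma blend_terminal:
  "blend c (\<lambda>w. \<tau> w + u * \<beta> w + v * \<delta> w) \<gamma> r i w x =
    blend c \<tau> \<gamma> r i w x + u * blend (\<lambda>_ _ _. 0) \<beta> \<gamma> r i w x + v * blend (\<lambda>_ _ _. 0) \<delta> \<gamma> r i w x"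
  by (induction r arbitrary: i w) (simp_all add: algebra_simps)

lemma blend_falling:
  "blend c \<tau> falling r (Suc i) (state x i) x =
    (\<Sum>j=Suc i..i + r. c j (state x (j - 1)) (x j)) + \<tau> (state x (i + r))"
proof (induction r arbitrary: i)
  case (Suc r)
  have "blend c \<tau> falling (Suc r) (Suc i) (state x i) x =
      c (Suc i) (state x i) (x (Suc i)) + blend c \<tau> falling r (Suc (Suc i)) (state x (Suc i)) x"
    by (simp add: falling_def target_def)
  also have "\<dots> = c (Suc i) (state x i) (x (Suc i)) +
      ((\<Sum>j=Suc (Suc i)..Suc i + r. c j (state x (j - 1)) (x j)) + \<tau> (state x (Suc i + r)))"
    by (simp only: Suc.IH)
  also have "\<dots> = (\<Sum>j=Suc i..i + Suc r. c j (state x (j - 1)) (x j)) + \<tau> (state x (i + Suc r))"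
    by (simp add: sum.atLeast_Suc_atMost[of "Suc i" "Suc (i + r)"] del: sum.cl_ivl_Suc)
  finally show ?case .
qed simp

lemma blend_falling_start:
  "blend c \<tau> falling r 1 0 x = (\<Sum>j=1..r. c j (state x (j - 1)) (x j)) + \<tau> (state x r)"
  using blend_falling[of c \<tau> r 0 x] by simp

lemma blend_nonneg:
  assumes "\<And>w. 0 \<le> \<gamma> w" "\<And>w. \<gamma> w \<le> 1" "\<And>j w y. 0 \<le> c j w y" "\<And>w. 0 \<le> \<tau> w"
  shows "0 \<le> blend c \<tau> \<gamma> r i w x"
  using assms by (induction r arbitrary: i w) auto

text \<open>A mixture does not exceed its larger branch, so the geometric series from
  \<open>q ^ i\<close> on dominates; the terminal cost counts as one more term of that
  series.\<close>

lemma blend_bound: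
  assumes \<gamma>: "\<And>w. 0 \<le> \<gamma> w" "\<And>w. \<gamma> w \<le> 1" and q: "0 < q" "q < 1"
    and c: "\<And>j w y. \<bar>c j w y\<bar> \<le> K * q ^ j" and \<tau>: "\<And>w. \<bar>\<tau> w\<bar> \<le> K * q ^ (i + r)" and K: "0 \<le> K"
  shows "\<bar>blend c \<tau> \<gamma> r i w x\<bar> \<le> K * q ^ i / (1 - q)"
  using \<tau>
proof (induction r arbitrary: i w)
  case 0
  have "\<bar>\<tau> w\<bar> \<le> K * q ^ i" using 0[of w] by simp
  also have "\<dots> \<le> K * q ^ i / (1 - q)"
    using q K by (simp add: le_divide_eq mult_left_le)
  finally show ?case by simp
next
  case (Suc r)
  let ?B = "K * q ^ Suc i / (1 - q)"
  let ?u = "blend c \<tau> \<gamma> r (Suc i) (w + (x i - b) / \<nu>) x"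
  let ?v = "blend c \<tau> \<gamma> r (Suc i) (w + (x i - a) / \<nu>) x"
  have "\<bar>blend c \<tau> \<gamma> r (Suc i) s x\<bar> \<le> ?B" for s
    using Suc.prems by (intro Suc.IH) simp
  then have "\<bar>?u\<bar> \<le> ?B" "\<bar>?v\<bar> \<le> ?B" by auto
  then have "\<gamma> w * \<bar>?u\<bar> \<le> \<gamma> w * ?B" "(1 - \<gamma> w) * \<bar>?v\<bar> \<le> (1 - \<gamma> w) * ?B"
    using \<gamma>[of w] by (intro mult_left_mono; simp)+
  then have "\<bar>\<gamma> w * ?u\<bar> \<le> \<gamma> w * ?B" "\<bar>(1 - \<gamma> w) * ?v\<bar> \<le> (1 - \<gamma> w) * ?B"
    using \<gamma>[of w] by (simp_all add: abs_mult)
  moreover have "\<gamma> w * ?B + (1 - \<gamma> w) * ?B = ?B" by algebra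
  ultimately have "\<bar>\<gamma> w * ?u + (1 - \<gamma> w) * ?v\<bar> \<le> ?B" by linarith
  moreover have "K * q ^ i + ?B = K * q ^ i / (1 - q)"
    using q by (simp add: field_simps)
  ultimately show ?case using c[of i w "x i"] by simp
qed

lemma blend_tendsto:
  assumes "\<And>w. (\<lambda>k. \<gamma>' k w) \<longlonglongrightarrow> \<gamma> w" "\<And>j w y. (\<lambda>k. c' k j w y) \<longlonglongrightarrow> c j w y"
    and "\<And>w. (\<lambda>k. \<tau>' k w) \<longlonglongrightarrow> \<tau> w"
  shows "(\<lambda>k. blend (c' k) (\<tau>' k) (\<gamma>' k) r i w x) \<longlonglongrightarrow> blend c \<tau> \<gamma> r i w x"
  using assms by (induction r arbitrary: i w) (auto intro!: tendsto_intros)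

lemma continuous_map_blend:
  assumes \<tau>: "continuous_on UNIV \<tau>" and \<gamma>: "continuous_on UNIV \<gamma>"
    and c: "\<And>j g h. continuous_map T euclideanreal g \<Longrightarrow> continuous_map T euclideanreal h \<Longrightarrow>
        continuous_map T euclideanreal (\<lambda>z. c j (g z) (h z))"
    and \<xi>: "\<And>j. i \<le> j \<Longrightarrow> j < i + r \<Longrightarrow> continuous_map T euclideanreal (\<lambda>z. \<xi> z j)"
    and w: "continuous_map T euclideanreal w"
  shows "continuous_map T euclideanreal (\<lambda>z. blend c \<tau> \<gamma> r i (w z) (\<xi> z))"
  using \<xi> w
proof (induction r arbitrary: i w)
  case 0
  then show ?case using continuous_map_real_comp[OF \<tau>] by simp
next
  case (Suc r)
  have "continuous_map T euclideanreal (\<lambda>z. w z + (\<xi> z i - s) / \<nu>)" for s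
    using Suc.prems by (simp add: divide_inverse) (intro continuous_intros; simp)
  then have "continuous_map T euclideanreal (\<lambda>z. blend c \<tau> \<gamma> r (Suc i) (w z + (\<xi> z i - s) / \<nu>) (\<xi> z))" for s
    using Suc.prems by (intro Suc.IH) auto
  then show ?case
    using Suc.prems by (auto intro!: continuous_intros c continuous_map_real_comp[OF \<gamma>])
qed

lemma measurable_blend:
  assumes [measurable]: "\<tau> \<in> borel_measurable borel" "\<gamma> \<in> borel_measurable borel"
    and c: "\<And>j. (\<lambda>(w, y). c j w y) \<in> borel_measurable (borel \<Otimes>\<^sub>M borel)"
    and \<xi>: "\<And>j. i \<le> j \<Longrightarrow> j < i + r \<Longrightarrow> (\<lambda>z. \<xi> z j) \<in> borel_measurable M"
    and w: "w \<in> borel_measurable M"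
  shows "(\<lambda>z. blend c \<tau> \<gamma> r i (w z) (\<xi> z)) \<in> borel_measurable M"
  using \<xi> w
proof (induction r arbitrary: i w)
  case 0
  note 0(2)[measurable]
  show ?case by simp
next
  case (Suc r)
  note Suc.prems(2)[measurable]
  have [measurable]: "(\<lambda>z. \<xi> z i) \<in> borel_measurable M" using Suc.prems by simp
  have [measurable]: "(\<lambda>z. c i (w z) (\<xi> z i)) \<in> borel_measurable M"
    using measurable_compose[OF _ c, of "\<lambda>z. (w z, \<xi> z i)" M i] by simp
  have [measurable]: "(\<lambda>z. blend c \<tau> \<gamma> r (Suc i) (w z + (\<xi> z i - s) / \<nu>) (\<xi> z)) \<in> borel_measurable M" for s
    using Suc.prems by (intro Suc.IH) auto
  show ?case by simp
qed

text \<open>Where \<open>dv\<close> is negative, passing from \<open>falling\<close> to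
  \<open>ramp k\<close> shifts the weight \<open>1 - ramp k w\<close> from the branch of
  \<open>b\<close> to that of \<open>a\<close> and gives up the bonus
  \<open>q ^ i * \<epsilon> * (1 - ramp k w)\<close>. By \<open>small\<close> the branches differ by
  at most \<open>q ^ i * \<epsilon>\<close>, so the shift cannot pay off. Elsewhere both weights are
  0. The fixed \<open>y0\<close> stands for the observation that follows the last step.\<close>

lemma blend_ramp_le:
  assumes q: "0 < q" and \<epsilon>: "0 < \<epsilon>" and J: "0 \<le> J" and small: "q * (2 * J + 3 * \<epsilon>) \<le> \<epsilon>"
    and f: "\<And>w y. \<bar>f w y\<bar> \<le> J"
  shows "blend (\<lambda>j w y. q ^ j * (f w y + \<epsilon> * ramp k w)) (\<lambda>w. q ^ (i + r) * (f w y0 + \<epsilon> * ramp k w)) (ramp k) r i w x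
    \<le> blend (\<lambda>j w y. q ^ j * (f w y + \<epsilon> * falling w)) (\<lambda>w. q ^ (i + r) * (f w y0 + \<epsilon> * falling w)) falling r i w x"
proof (induction r arbitrary: i w)
  case 0
  show ?case using ramp_bounds[of k w] q \<epsilon> by simp
next
  case (Suc r)
  \<comment> \<open>Dropping \<open>J\<close> from \<open>small\<close> already forces
    \<open>q \<le> 1 / 3\<close>, so the geometric series converges.\<close>
  have "q * (2 * J + 3 * \<epsilon>) \<le> \<epsilon>" by fact
  moreover have "q * (2 * J + 3 * \<epsilon>) \<ge> q * (3 * \<epsilon>)" using q J by (intro mult_left_mono) auto
  ultimately have "(q * 3) * \<epsilon> \<le> 1 * \<epsilon>" by simp
  then have "q * 3 \<le> 1" using \<epsilon> by (subst (asm) mult_le_cancel_right) auto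
  then have q1: "q < 1" by simp
  have cb: "\<bar>q ^ j * (f w y + \<epsilon> * falling w)\<bar> \<le> (J + \<epsilon>) * q ^ j" for j w y
  proof -
    have "\<bar>f w y + \<epsilon> * falling w\<bar> \<le> J + \<epsilon>"
      using f[of w y] \<epsilon> by (auto simp: falling_def)
    then have "q ^ j * \<bar>f w y + \<epsilon> * falling w\<bar> \<le> q ^ j * (J + \<epsilon>)"
      using q by (intro mult_left_mono) auto
    then show ?thesis using q by (simp add: abs_mult mult.commute)
  qed
  let ?H = "\<lambda>s. blend (\<lambda>j w y. q ^ j * (f w y + \<epsilon> * falling w))
    (\<lambda>w. q ^ (i + Suc r) * (f w y0 + \<epsilon> * falling w)) falling r (Suc i) (w + (x i - s) / \<nu>) x"
  let ?G = "\<lambda>s. blend (\<lambda>j w y. q ^ j * (f w y + \<epsilon> * ramp k w))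
    (\<lambda>w. q ^ (i + Suc r) * (f w y0 + \<epsilon> * ramp k w)) (ramp k) r (Suc i) (w + (x i - s) / \<nu>) x"
  have H: "\<bar>?H s\<bar> \<le> (J + \<epsilon>) * q ^ Suc i / (1 - q)" for s
    using cb q q1 J \<epsilon> falling_bounds by (intro blend_bound) (auto simp del: power_Suc)
  have "2 * ((J + \<epsilon>) * q ^ Suc i / (1 - q)) = q ^ i * ((2 * (J + \<epsilon>) * q) / (1 - q))" by simp
  also have "\<dots> \<le> q ^ i * \<epsilon>"
    using small q q1 by (intro mult_left_mono) (auto simp: divide_le_eq algebra_simps)
  finally have bonus: "?H a - ?H b \<le> q ^ i * \<epsilon>"
    using H[of a] H[of b] by linarith
  have GH: "?G s \<le> ?H s" for s
    using Suc.IH[of "Suc i"] by simp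
  have "ramp k w * ?G b + (1 - ramp k w) * ?G a \<le> ramp k w * ?H b + (1 - ramp k w) * ?H a"
    using GH[of a] GH[of b] ramp_bounds[of k w] by (intro add_mono mult_left_mono) auto
  moreover have "q ^ i * (\<epsilon> * ramp k w) + (ramp k w * ?H b + (1 - ramp k w) * ?H a) \<le>
      q ^ i * (\<epsilon> * falling w) + (falling w * ?H b + (1 - falling w) * ?H a)"
  proof (cases "dv w < 0")
    case True
    have "(1 - ramp k w) * (?H a - ?H b) \<le> (1 - ramp k w) * (q ^ i * \<epsilon>)"
      using bonus ramp_bounds[of k w] by (intro mult_left_mono) auto
    then show ?thesis using True by (simp add: falling_def algebra_simps)
  next
    case False
    then show ?thesis by (simp add: falling_def ramp_def)
  qed
  ultimately show ?case by (simp add: algebra_simps)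
qed

end

subsection \<open>Sublinear expectations of bounded functions\<close>

locale iid_sequence_space =
  fixes M :: "'a measure" and P :: "'t \<Rightarrow> 'a measure" and \<Theta> :: "'t set" and X :: "nat \<Rightarrow> 'a \<Rightarrow> real"
  assumes nonempty: "\<Theta> \<noteq> {}"
    and prob_space_P: "\<And>\<theta>. \<theta> \<in> \<Theta> \<Longrightarrow> prob_space (P \<theta>)"
    and sets_P: "\<And>\<theta>. \<theta> \<in> \<Theta> \<Longrightarrow> sets (P \<theta>) = sets M"
    and measurable_X [measurable]: "\<And>i. i \<ge> 1 \<Longrightarrow> X i \<in> borel_measurable M"
    and iid: "iid_sequence P \<Theta> X"
begin

abbreviation EE :: "('a \<Rightarrow> real) \<Rightarrow> real"
  where "EE \<equiv> sublinear_expectation P \<Theta>"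

lemma measurable_P: "\<theta> \<in> \<Theta> \<Longrightarrow> Z \<in> measurable M N \<Longrightarrow> Z \<in> measurable (P \<theta>) N"
  using sets_P measurable_cong_sets by blast

lemma measurable_X_Suc [measurable]: "X (Suc m) \<in> borel_measurable M"
  by (rule measurable_X) simp

lemma integrable_bounded:
  fixes Z :: "'a \<Rightarrow> real"
  assumes "\<theta> \<in> \<Theta>" "Z \<in> borel_measurable M" "\<And>\<omega>. \<bar>Z \<omega>\<bar> \<le> B"
  shows "integrable (P \<theta>) Z"
proof -
  interpret prob_space "P \<theta>" using assms(1) by (rule prob_space_P)
  show ?thesis
    using assms measurable_P by (intro integrable_const_bound[where B = B]) auto
qed

lemma integral_bounded:
  fixes Z :: "'a \<Rightarrow> real"
  assumes "\<theta> \<in> \<Theta>" "Z \<in> borel_measurable M" "\<And>\<omega>. \<bar>Z \<omega>\<bar> \<le> B"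
  shows "\<bar>\<integral>\<omega>. Z \<omega> \<partial>P \<theta>\<bar> \<le> B"
proof -
  interpret prob_space "P \<theta>" using assms(1) by (rule prob_space_P)
  have "integrable (P \<theta>) Z" using assms by (rule integrable_bounded)
  moreover have "Z \<omega> \<le> B" "- B \<le> Z \<omega>" for \<omega>
    using assms(3)[of \<omega>] by auto
  ultimately have "expectation Z \<le> B" "- B \<le> expectation Z"
    by (auto intro!: integral_le_const integral_ge_const)
  then show ?thesis by simp
qed

lemma integral_le_EE:
  assumes "\<theta> \<in> \<Theta>" "Z \<in> borel_measurable M" "\<And>\<omega>. \<bar>Z \<omega>\<bar> \<le> B"
  shows "(\<integral>\<omega>. Z \<omega> \<partial>P \<theta>) \<le> EE Z"
  unfolding sublinear_expectation_def
proof (rule cSUP_upper[OF assms(1)])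
  show "bdd_above ((\<lambda>\<theta>. \<integral>\<omega>. Z \<omega> \<partial>P \<theta>) ` \<Theta>)"
    using integral_bounded[OF _ assms(2,3)] by (auto intro!: bdd_aboveI2[where M = B] simp: abs_le_iff)
qed

lemma EE_le:
  assumes "\<And>\<theta>. \<theta> \<in> \<Theta> \<Longrightarrow> (\<integral>\<omega>. Z \<omega> \<partial>P \<theta>) \<le> c"
  shows "EE Z \<le> c"
  unfolding sublinear_expectation_def using nonempty assms by (rule cSUP_least)

lemma EE_bounded:
  assumes "Z \<in> borel_measurable M" "\<And>\<omega>. \<bar>Z \<omega>\<bar> \<le> B"
  shows "\<bar>EE Z\<bar> \<le> B"
proof -
  obtain \<theta> where \<theta>: "\<theta> \<in> \<Theta>" using nonempty by auto
  have "EE Z \<le> B" using integral_bounded[OF _ assms] by (intro EE_le) (auto simp: abs_le_iff)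
  moreover have "- B \<le> EE Z"
    using integral_le_EE[OF \<theta> assms] integral_bounded[OF \<theta> assms] by linarith
  ultimately show ?thesis by simp
qed

lemma EE_mono:
  assumes "Z \<in> borel_measurable M" "\<And>\<omega>. \<bar>Z \<omega>\<bar> \<le> B" "Y \<in> borel_measurable M" "\<And>\<omega>. \<bar>Y \<omega>\<bar> \<le> B'"
    and le: "\<And>\<omega>. Z \<omega> \<le> Y \<omega>"
  shows "EE Z \<le> EE Y"
proof (rule EE_le)
  fix \<theta> assume \<theta>: "\<theta> \<in> \<Theta>"
  have "(\<integral>\<omega>. Z \<omega> \<partial>P \<theta>) \<le> (\<integral>\<omega>. Y \<omega> \<partial>P \<theta>)"
    using assms \<theta> by (intro integral_mono integrable_bounded) auto
  also have "\<dots> \<le> EE Y" using \<theta> assms(3,4) by (rule integral_le_EE)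
  finally show "(\<integral>\<omega>. Z \<omega> \<partial>P \<theta>) \<le> EE Y" .
qed

lemma EE_const: "EE (\<lambda>_. c) = c"
proof -
  have int: "(\<integral>\<omega>. c \<partial>P \<theta>) = c" if "\<theta> \<in> \<Theta>" for \<theta>
  proof -
    interpret prob_space "P \<theta>" using that by (rule prob_space_P)
    show ?thesis by (simp add: prob_space)
  qed
  have "EE (\<lambda>_. c) = (SUP \<theta>\<in>\<Theta>. c)"
    unfolding sublinear_expectation_def using int by (rule SUP_cong[OF refl])
  then show ?thesis using nonempty by simp
qed

lemma integral_affine:
  fixes Z :: "'a \<Rightarrow> real"
  assumes "\<theta> \<in> \<Theta>" "integrable (P \<theta>) Z"
  shows "(\<integral>\<omega>. \<kappa> * Z \<omega> + c \<partial>P \<theta>) = \<kappa> * (\<integral>\<omega>. Z \<omega> \<partial>P \<theta>) + c"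
proof -
  interpret prob_space "P \<theta>" using assms(1) by (rule prob_space_P)
  show ?thesis using assms(2) by (simp add: prob_space)
qed

lemma EE_scale:
  assumes Z: "Z \<in> borel_measurable M" "\<And>\<omega>. \<bar>Z \<omega>\<bar> \<le> B" and \<kappa>: "0 \<le> \<kappa>"
  shows "EE (\<lambda>\<omega>. \<kappa> * Z \<omega> + c) = \<kappa> * EE Z + c"
proof (cases "\<kappa> = 0")
  case True
  then show ?thesis by (simp add: EE_const)
next
  case False
  with \<kappa> have \<kappa>': "0 < \<kappa>" by simp
  have int: "(\<integral>\<omega>. \<kappa> * Z \<omega> + c \<partial>P \<theta>) = \<kappa> * (\<integral>\<omega>. Z \<omega> \<partial>P \<theta>) + c" if "\<theta> \<in> \<Theta>" for \<theta>
    using that Z by (intro integral_affine integrable_bounded)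
  have "\<bar>\<kappa> * Z \<omega> + c\<bar> \<le> \<kappa> * B + \<bar>c\<bar>" for \<omega>
    using mult_left_mono[OF Z(2)[of \<omega>] \<kappa>] \<kappa> abs_triangle_ineq[of "\<kappa> * Z \<omega>" c] by (simp add: abs_mult)
  then have up: "(\<integral>\<omega>. \<kappa> * Z \<omega> + c \<partial>P \<theta>) \<le> EE (\<lambda>\<omega>. \<kappa> * Z \<omega> + c)" if "\<theta> \<in> \<Theta>" for \<theta>
    using that Z by (intro integral_le_EE) auto
  show ?thesis
  proof (rule antisym)
    show "EE (\<lambda>\<omega>. \<kappa> * Z \<omega> + c) \<le> \<kappa> * EE Z + c"
      using \<kappa> integral_le_EE[OF _ Z] by (intro EE_le) (auto simp: int intro!: mult_left_mono)
    have "EE Z \<le> (EE (\<lambda>\<omega>. \<kappa> * Z \<omega> + c) - c) / \<kappa>"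
      using up int \<kappa>' by (intro EE_le) (auto simp: le_divide_eq algebra_simps)
    then show "\<kappa> * EE Z + c \<le> EE (\<lambda>\<omega>. \<kappa> * Z \<omega> + c)"
      using \<kappa>' by (simp add: le_divide_eq algebra_simps)
  qed
qed

lemma EE_affine:
  assumes Z: "Z \<in> borel_measurable M" "\<And>\<omega>. \<bar>Z \<omega>\<bar> \<le> B"
  shows "EE (\<lambda>\<omega>. \<kappa> * Z \<omega> + c) = (if \<kappa> \<ge> 0 then \<kappa> * EE Z else \<kappa> * (- EE (\<lambda>\<omega>. - Z \<omega>))) + c"
  using EE_scale[of Z B \<kappa> c] EE_scale[of "\<lambda>\<omega>. - Z \<omega>" B "- \<kappa>" c] Z by auto

section \<open>Independence of the next observation from the past\<close>

definition history :: "nat \<Rightarrow> 'a \<Rightarrow> nat \<Rightarrow> real"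
  where "history m \<omega> = (\<lambda>j\<in>{1..m}. X j \<omega>)"

text \<open>The i.i.d. property starts with one past observation. With an empty past the history is
  constant, and the claim reduces to the sublinear expectation of a constant.\<close>

lemma independent_history:
  "independent_of P \<Theta> euclideanreal (X (Suc m)) (powertop_real {1..m}) (history m)"
proof (cases m)
  case 0
  then show ?thesis
    unfolding independent_of_def history_def by (simp add: EE_const restrict_def)
next
  case (Suc i)
  then show ?thesis
    using iid unfolding iid_sequence_def history_def by simp
qed

lemma EE_identically_distributed:
  assumes "continuous_on UNIV h" "\<And>y. \<bar>h y\<bar> \<le> T"
  shows "EE (\<lambda>\<omega>. h (X (Suc m) \<omega>)) = EE (\<lambda>\<omega>. h (X 1 \<omega>))"
proof (cases m)
  case (Suc i)
  have "bounded (range h)" using assms(2) by (auto simp: bounded_iff)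
  then show ?thesis
    using iid assms(1) Suc unfolding iid_sequence_def identically_distributed_def by simp
qed simp

text \<open>For a fixed past the expression is affine in the next \<open>h\<close>-value with slope
  \<open>B - C\<close>; the inner supremum picks \<open>p\<close> or \<open>q\<close> by the sign of
  the slope, and the minimum unites the two cases. Blends average over several states, so
  \<open>B\<close> and \<open>C\<close> may both be positive; on an unblended path they will be the
  positive and negative part of one number, and the subtracted term vanishes.\<close>

lemma EE_independent_affine:
  assumes cont: "continuous_map (powertop_real {1..m}) euclideanreal A"
      "continuous_map (powertop_real {1..m}) euclideanreal B"
      "continuous_map (powertop_real {1..m}) euclideanreal C"
    and bound: "\<And>z. \<bar>A z\<bar> \<le> c" "\<And>z. \<bar>B z\<bar> \<le> c" "\<And>z. \<bar>C z\<bar> \<le> c"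
    and h: "continuous_on UNIV h" "\<And>y. \<bar>h y\<bar> \<le> T"
    and p: "p = EE (\<lambda>\<omega>. h (X 1 \<omega>))" and q: "q = - EE (\<lambda>\<omega>. - h (X 1 \<omega>))"
  shows "EE (\<lambda>\<omega>. A (history m \<omega>) + B (history m \<omega>) * (h (X (Suc m) \<omega>) - p) +
        C (history m \<omega>) * (q - h (X (Suc m) \<omega>))) =
      EE (\<lambda>\<omega>. A (history m \<omega>) - min (B (history m \<omega>)) (C (history m \<omega>)) * (p - q))"
proof -
  have [measurable]: "h \<in> borel_measurable borel"
    using h(1) by (rule borel_measurable_continuous_onI)
  let ?T = "powertop_real {1..m}"
  let ?f = "\<lambda>(z, y). A z + B z * (h y - p) + C z * (q - h y)"
  have "continuous_map (prod_topology ?T euclideanreal) euclideanreal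
      (\<lambda>u. A (fst u) + B (fst u) * (h (snd u) - p) + C (fst u) * (q - h (snd u)))"
    using cont continuous_map_real_comp[OF h(1) continuous_map_snd]
    by (auto intro!: continuous_intros intro: continuous_map_of_fst simp: continuous_map_of_fst[unfolded o_def])
  then have "continuous_map (prod_topology ?T euclideanreal) euclideanreal ?f"
    by (simp add: case_prod_beta')
  moreover have "\<bar>?f u\<bar> \<le> c + c * (T + \<bar>p\<bar>) + c * (\<bar>q\<bar> + T)" for u
  proof -
    obtain z y where u: "u = (z, y)" by (cases u)
    have "\<bar>B z * (h y - p)\<bar> \<le> c * (T + \<bar>p\<bar>)" "\<bar>C z * (q - h y)\<bar> \<le> c * (\<bar>q\<bar> + T)"
      unfolding abs_mult using bound(2,3)[of z] h(2)[of y]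
      by (intro mult_mono; linarith)+
    then show ?thesis using bound(1)[of z] u by simp
  qed
  then have "bounded (?f ` topspace (prod_topology ?T euclideanreal))"
    by (auto simp: bounded_iff)
  ultimately have "EE (\<lambda>\<omega>. ?f (history m \<omega>, X (Suc m) \<omega>)) =
      EE (\<lambda>\<omega>. EE (\<lambda>\<omega>'. ?f (history m \<omega>, X (Suc m) \<omega>')))"
    using independent_history[of m] unfolding independent_of_def by blast
  moreover have "EE (\<lambda>\<omega>'. ?f (z, X (Suc m) \<omega>')) = A z - min (B z) (C z) * (p - q)" for z
  proof -
    have "EE (\<lambda>\<omega>'. ?f (z, X (Suc m) \<omega>')) =
        EE (\<lambda>\<omega>'. (B z - C z) * h (X (Suc m) \<omega>') + (A z - B z * p + C z * q))"
      by (simp add: algebra_simps)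
    also have "\<dots> = (if B z - C z \<ge> 0 then (B z - C z) * p else (B z - C z) * q) + (A z - B z * p + C z * q)"
      using EE_identically_distributed[of h T m] EE_identically_distributed[of "\<lambda>y. - h y" T m] h
      by (subst EE_affine[where B = T]) (auto simp: p q intro!: continuous_intros)
    also have "\<dots> = A z - min (B z) (C z) * (p - q)"
      by (auto simp: min_def algebra_simps)
    finally show ?thesis .
  qed
  ultimately show ?thesis by simp
qed

end

subsection \<open>One-step estimates\<close>

text \<open>The path decides which of the two centerings occurs, so the squared deviation must be
  bounded around both \<open>a\<close> and \<open>b\<close>. In the application \<open>S\<close> is
  \<open>2 * C\<^sub>0\<close>.\<close>

locale switched_iid = iid_sequence_space M P \<Theta> X + switched_path dv a b \<nu>
  for M :: "'a measure" and P :: "'t \<Rightarrow> 'a measure" and \<Theta> :: "'t set" and X :: "nat \<Rightarrow> 'a \<Rightarrow> real"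
    and dv :: "real \<Rightarrow> real" and a b \<nu> :: real +
  fixes L S :: real
  assumes lipschitz_dv: "L-lipschitz_on UNIV dv"
    and a_def: "a = EE (X 1)" and b_def: "b = - EE (\<lambda>\<omega>. - X 1 \<omega>)"
    and integral_X1_bounds: "\<And>\<theta>. \<theta> \<in> \<Theta> \<Longrightarrow> b \<le> (\<integral>\<omega>. X 1 \<omega> \<partial>P \<theta>) \<and> (\<integral>\<omega>. X 1 \<omega> \<partial>P \<theta>) \<le> a"
    and integrable_square_dev: "\<And>\<theta> s. \<theta> \<in> \<Theta> \<Longrightarrow> s \<in> {a, b} \<Longrightarrow> integrable (P \<theta>) (\<lambda>\<omega>. (X 1 \<omega> - s)\<^sup>2)"
    and square_dev_le: "\<And>\<theta> s. \<theta> \<in> \<Theta> \<Longrightarrow> s \<in> {a, b} \<Longrightarrow> (\<integral>\<omega>. (X 1 \<omega> - s)\<^sup>2 \<partial>P \<theta>) \<le> S"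
begin

definition W :: "nat \<Rightarrow> 'a \<Rightarrow> real"
  where "W m \<omega> = state (\<lambda>j. X j \<omega>) m"

definition dev :: "nat \<Rightarrow> 'a \<Rightarrow> real"
  where "dev m \<omega> = X (Suc m) \<omega> - target (W m \<omega>)"

lemma S_nonneg: "0 \<le> S"
proof -
  obtain \<theta> where \<theta>: "\<theta> \<in> \<Theta>" using nonempty by auto
  have "0 \<le> (\<integral>\<omega>. (X 1 \<omega> - a)\<^sup>2 \<partial>P \<theta>)" by (rule integral_nonneg_AE) simp
  also have "\<dots> \<le> S" using \<theta> by (intro square_dev_le) auto
  finally show ?thesis .
qed

lemma continuous_dv: "continuous_on UNIV dv"
  using lipschitz_dv by (rule lipschitz_on_continuous_on)

lemma measurable_dv [measurable]: "dv \<in> borel_measurable borel"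
  using continuous_dv by (rule borel_measurable_continuous_onI)

lemma measurable_target [measurable]: "target \<in> borel_measurable borel"
  unfolding target_def by measurable

lemma measurable_falling [measurable]: "falling \<in> borel_measurable borel"
  unfolding falling_def by measurable

lemma measurable_ramp [measurable]: "ramp k \<in> borel_measurable borel"
  unfolding ramp_def by measurable

lemma W_0: "W 0 \<omega> = 0"
  by (simp add: W_def)

lemma W_Suc: "W (Suc m) \<omega> = W m \<omega> + dev m \<omega> / \<nu>"
  by (simp add: W_def dev_def)

lemma measurable_W [measurable]: "W m \<in> borel_measurable M"
proof (induction m)
  case 0
  then show ?case unfolding W_0[abs_def] by simp
next
  case (Suc m)
  note Suc[measurable]
  show ?case unfolding W_Suc[abs_def] dev_def[abs_def] by measurable
qed

lemma measurable_dev [measurable]: "dev m \<in> borel_measurable M"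
  unfolding dev_def by measurable

lemma blend_history: "blend c \<tau> \<gamma> m 1 0 (history m \<omega>) = blend c \<tau> \<gamma> m 1 0 (\<lambda>j. X j \<omega>)"
  by (rule blend_cong) (auto simp: history_def)

lemma measurable_blend_history:
  assumes "\<tau> \<in> borel_measurable borel" "\<gamma> \<in> borel_measurable borel"
    and "\<And>j. (\<lambda>(w, y). c j w y) \<in> borel_measurable (borel \<Otimes>\<^sub>M borel)"
  shows "(\<lambda>\<omega>. blend c \<tau> \<gamma> m 1 0 (history m \<omega>)) \<in> borel_measurable M"
  unfolding blend_history by (intro measurable_blend assms) auto

lemma continuous_map_blend_history:
  assumes "continuous_on UNIV \<tau>" "continuous_on UNIV \<gamma>"
    and "\<And>j g h. continuous_map (powertop_real {1..m}) euclideanreal g \<Longrightarrow>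
        continuous_map (powertop_real {1..m}) euclideanreal h \<Longrightarrow>
        continuous_map (powertop_real {1..m}) euclideanreal (\<lambda>z. c j (g z) (h z))"
  shows "continuous_map (powertop_real {1..m}) euclideanreal (blend c \<tau> \<gamma> m 1 0)"
proof -
  have "continuous_map (powertop_real {1..m}) euclideanreal
      (\<lambda>z. blend c \<tau> \<gamma> m 1 ((\<lambda>_. 0) z) ((\<lambda>z. z) z))"
    by (intro continuous_map_blend assms) (auto intro!: continuous_map_product_projection)
  then show ?thesis by simp
qed

text \<open>Together with \<open>blend_tendsto\<close> this exhibits a function of
  \<open>W m\<close>, which is discontinuous in the observations, as a limit of continuous functions
  of the history.\<close>

lemma blend_terminal_falling: "blend (\<lambda>_ _ _. 0) \<tau> falling m 1 0 (\<lambda>j. X j \<omega>) = \<tau> (W m \<omega>)"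
  using blend_falling_start[of "\<lambda>_ _ _. 0" \<tau> m] by (simp add: W_def)

text \<open>
  The conditional expectation of \<open>h (X (Suc m))\<close> given the past is at most \<open>EE (h (X 1))\<close> under
  every \<open>P \<theta>\<close>; the past enters through weights that are limits of continuous ones.
\<close>

lemma integral_W_mult_le:
  assumes \<theta>: "\<theta> \<in> \<Theta>" and h: "continuous_on UNIV h" "\<And>y. \<bar>h y\<bar> \<le> T"
    and g: "\<And>k. continuous_on UNIV (g k)" "\<And>k w. 0 \<le> g k w" "\<And>k w. g k w \<le> c"
    and lim: "\<And>w. (\<lambda>k. g k w) \<longlonglongrightarrow> \<psi> w"
  shows "(\<integral>\<omega>. \<psi> (W m \<omega>) * h (X (Suc m) \<omega>) \<partial>P \<theta>) \<le> EE (\<lambda>\<omega>. h (X 1 \<omega>)) * (\<integral>\<omega>. \<psi> (W m \<omega>) \<partial>P \<theta>)"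
proof -
  interpret prob_space "P \<theta>" using \<theta> by (rule prob_space_P)
  have [measurable]: "h \<in> borel_measurable borel" "\<And>k. g k \<in> borel_measurable borel"
    using h(1) g(1) by (auto intro: borel_measurable_continuous_onI)
  have [measurable]: "\<psi> \<in> borel_measurable borel"
    by (rule borel_measurable_LIMSEQ_real[OF lim]) simp
  have \<psi>: "0 \<le> \<psi> w" "\<psi> w \<le> c" for w
    using LIMSEQ_le_const[OF lim] LIMSEQ_le_const2[OF lim] g by blast+
  have "0 \<le> c" using g(2)[of 0 0] g(3)[of 0 0] by linarith
  define p where "p = EE (\<lambda>\<omega>. h (X 1 \<omega>))"
  define B where "B k = blend (\<lambda>_ _ _. 0) (g k) (ramp k) m 1 0" for k
  obtain c' where B: "\<And>k z. \<bar>B k z\<bar> \<le> c'"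
  proof
    \<comment> \<open>The ratio 1/2 is arbitrary: there are no running costs, and the factor
      \<open>2 ^ (1 + m)\<close> makes the bound required of the terminal cost equal to
      \<open>c\<close>.\<close>
    show "\<bar>B k z\<bar> \<le> c * 2 ^ (1 + m) * (1 / 2) ^ 1 / (1 - 1 / 2)" for k z
      unfolding B_def using g \<open>0 \<le> c\<close> ramp_bounds
      by (intro blend_bound) (auto simp: power_one_over)
  qed
  have B0: "0 \<le> B k z" for k z
    unfolding B_def using g ramp_bounds by (intro blend_nonneg) auto
  have Bm [measurable]: "(\<lambda>\<omega>. B k (history m \<omega>)) \<in> borel_measurable M" for k
    unfolding B_def by (intro measurable_blend_history) auto
  have Bc: "continuous_map (powertop_real {1..m}) euclideanreal (B k)" for k
    unfolding B_def by (intro continuous_map_blend_history g continuous_ramp continuous_dv) auto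
  have prod: "\<bar>B k z * (h y - p)\<bar> \<le> c' * (T + \<bar>p\<bar>)" for k z y
    unfolding abs_mult using B[of k z] h(2)[of y] by (intro mult_mono) auto
  have step: "(\<integral>\<omega>. B k (history m \<omega>) * (h (X (Suc m) \<omega>) - p) \<partial>P \<theta>) \<le> 0" for k
  proof -
    have "(\<integral>\<omega>. B k (history m \<omega>) * (h (X (Suc m) \<omega>) - p) \<partial>P \<theta>) \<le>
        EE (\<lambda>\<omega>. B k (history m \<omega>) * (h (X (Suc m) \<omega>) - p))"
      using \<theta> prod by (intro integral_le_EE) auto
    \<comment> \<open>With \<open>B k\<close> nonnegative and 0 in the place of \<open>C\<close> the
      minimum is 0, so nothing remains.\<close>
    also have "\<dots> = EE (\<lambda>_. 0)"
      using EE_independent_affine[of m "\<lambda>_. 0" "B k" "\<lambda>_. 0" c' h T p, OF _ Bc _ _ B _ h p_def refl]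
        B0 order_trans[OF abs_ge_zero B] by (simp add: min_absorb2)
    finally show ?thesis by (simp add: EE_const)
  qed
  have "(\<lambda>k. \<integral>\<omega>. B k (history m \<omega>) * (h (X (Suc m) \<omega>) - p) \<partial>P \<theta>)
      \<longlonglongrightarrow> (\<integral>\<omega>. \<psi> (W m \<omega>) * (h (X (Suc m) \<omega>) - p) \<partial>P \<theta>)"
  proof (rule integral_dominated_convergence)
    show "integrable (P \<theta>) (\<lambda>_. c' * (T + \<bar>p\<bar>))" by simp
    show "AE \<omega> in P \<theta>. norm (B k (history m \<omega>) * (h (X (Suc m) \<omega>) - p)) \<le> c' * (T + \<bar>p\<bar>)" for k
      using prod by simp
    have "(\<lambda>k. B k (history m \<omega>)) \<longlonglongrightarrow> \<psi> (W m \<omega>)" for \<omega>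
      unfolding B_def blend_history blend_terminal_falling[symmetric]
      by (intro blend_tendsto ramp_tendsto lim tendsto_const)
    then show "AE \<omega> in P \<theta>. (\<lambda>k. B k (history m \<omega>) * (h (X (Suc m) \<omega>) - p))
        \<longlonglongrightarrow> \<psi> (W m \<omega>) * (h (X (Suc m) \<omega>) - p)"
      by (auto intro!: tendsto_intros)
  qed (auto intro!: measurable_P[OF \<theta>])
  then have "(\<integral>\<omega>. \<psi> (W m \<omega>) * (h (X (Suc m) \<omega>) - p) \<partial>P \<theta>) \<le> 0"
    by (rule LIMSEQ_le_const2) (use step in auto)
  moreover have "integrable (P \<theta>) (\<lambda>\<omega>. \<psi> (W m \<omega>))"
    using \<psi> by (intro integrable_bounded[OF \<theta>, where B = c]) auto
  moreover have "integrable (P \<theta>) (\<lambda>\<omega>. \<psi> (W m \<omega>) * h (X (Suc m) \<omega>))"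
  proof (intro integrable_bounded[OF \<theta>, where B = "c * T"])
    show "\<bar>\<psi> (W m \<omega>) * h (X (Suc m) \<omega>)\<bar> \<le> c * T" for \<omega>
      unfolding abs_mult using \<psi>[of "W m \<omega>"] h(2)[of "X (Suc m) \<omega>"] by (intro mult_mono) auto
  qed measurable
  ultimately show ?thesis
    by (simp add: right_diff_distrib p_def mult.commute)
qed

text \<open>The deviation is taken from \<open>b\<close> or from \<open>a\<close> according to
  \<open>falling\<close>, so its square splits into two products of a weight in \<open>W m\<close>
  and a square to which \<open>integral_W_mult_le\<close> applies once it is cut off at
  \<open>N\<close>. Fatou's lemma removes the cut. Extended integrals are used since integrability
  of the square is a consequence and not yet known.\<close>

lemma nn_integral_square_dev_le:
  assumes \<theta>: "\<theta> \<in> \<Theta>" and \<psi>: "continuous_on UNIV \<psi>" "\<And>w. 0 \<le> \<psi> w"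
  shows "(\<integral>\<^sup>+\<omega>. ennreal (\<psi> (W m \<omega>) * (dev m \<omega>)\<^sup>2) \<partial>P \<theta>) \<le> ennreal S * (\<integral>\<^sup>+\<omega>. ennreal (\<psi> (W m \<omega>)) \<partial>P \<theta>)"
proof -
  interpret prob_space "P \<theta>" using \<theta> by (rule prob_space_P)
  have [measurable]: "\<psi> \<in> borel_measurable borel"
    using \<psi>(1) by (rule borel_measurable_continuous_onI)
  have S0: "0 \<le> S"
    by (rule S_nonneg)
  let ?Z = "\<lambda>N \<omega>. min (\<psi> (W m \<omega>)) (real N) * min ((dev m \<omega>)\<^sup>2) (real N)"
  have EEh: "EE (\<lambda>\<omega>. min ((X 1 \<omega> - s)\<^sup>2) (real N)) \<le> S" if "s \<in> {a, b}" for s N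
  proof (rule EE_le)
    fix \<theta>' assume \<theta>': "\<theta>' \<in> \<Theta>"
    have "(\<integral>\<omega>. min ((X 1 \<omega> - s)\<^sup>2) (real N) \<partial>P \<theta>') \<le> (\<integral>\<omega>. (X 1 \<omega> - s)\<^sup>2 \<partial>P \<theta>')"
      by (rule integral_mono[OF integrable_bounded[OF \<theta>', where B = "real N"]
            integrable_square_dev[OF \<theta>' that]]) auto
    then show "(\<integral>\<omega>. min ((X 1 \<omega> - s)\<^sup>2) (real N) \<partial>P \<theta>') \<le> S"
      using square_dev_le[OF \<theta>' that] by linarith
  qed
  have bound: "(\<integral>\<omega>. ?Z N \<omega> \<partial>P \<theta>) \<le> S * (\<integral>\<omega>. min (\<psi> (W m \<omega>)) (real N) \<partial>P \<theta>)" for N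
  proof -
    let ?\<psi> = "\<lambda>w. min (\<psi> w) (real N)"
    have part: "(\<integral>\<omega>. (?\<psi> (W m \<omega>) * u (W m \<omega>)) * min ((X (Suc m) \<omega> - s)\<^sup>2) (real N) \<partial>P \<theta>) \<le>
        S * (\<integral>\<omega>. ?\<psi> (W m \<omega>) * u (W m \<omega>) \<partial>P \<theta>)"
      if s: "s \<in> {a, b}" and u: "\<And>k. continuous_on UNIV (U k)" "\<And>k w. 0 \<le> U k w" "\<And>k w. U k w \<le> 1"
        "\<And>w. (\<lambda>k. U k w) \<longlonglongrightarrow> u w" for s U u
    proof -
      have u0: "0 \<le> u w" for w using LIMSEQ_le_const[OF u(4)] u(2) by blast
      have "(\<integral>\<omega>. (?\<psi> (W m \<omega>) * u (W m \<omega>)) * min ((X (Suc m) \<omega> - s)\<^sup>2) (real N) \<partial>P \<theta>) \<le>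
        EE (\<lambda>\<omega>. min ((X 1 \<omega> - s)\<^sup>2) (real N)) * (\<integral>\<omega>. ?\<psi> (W m \<omega>) * u (W m \<omega>) \<partial>P \<theta>)"
      proof (rule integral_W_mult_le[OF \<theta>, where h = "\<lambda>y. min ((y - s)\<^sup>2) (real N)" and
            g = "\<lambda>k w. ?\<psi> w * U k w" and c = "real N" and T = "real N" and \<psi> = "\<lambda>w. ?\<psi> w * u w"])
        show "?\<psi> w * U k w \<le> real N" for k w
          using mult_mono[of "?\<psi> w" "real N" "U k w" 1] u \<psi>(2)[of w] by auto
      qed (use u \<psi> in \<open>auto intro!: continuous_intros tendsto_intros mult_nonneg_nonneg\<close>)
      also have "\<dots> \<le> S * (\<integral>\<omega>. ?\<psi> (W m \<omega>) * u (W m \<omega>) \<partial>P \<theta>)"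
        using EEh[OF s] u0 \<psi>(2) by (intro mult_right_mono integral_nonneg_AE) auto
      finally show ?thesis .
    qed
    have int: "integrable (P \<theta>) (\<lambda>\<omega>. ?\<psi> (W m \<omega>) * u (W m \<omega>))"
      and int': "integrable (P \<theta>) (\<lambda>\<omega>. ?\<psi> (W m \<omega>) * u (W m \<omega>) * min ((X (Suc m) \<omega> - s)\<^sup>2) (real N))"
      if [measurable]: "u \<in> borel_measurable borel" and u: "\<And>w. 0 \<le> u w" "\<And>w. u w \<le> 1" for u s
    proof -
      have le: "\<bar>?\<psi> w * u w\<bar> \<le> real N" for w
        using mult_mono[of "?\<psi> w" "real N" "u w" 1] u \<psi>(2)[of w] by (auto simp: abs_mult)
      then show "integrable (P \<theta>) (\<lambda>\<omega>. ?\<psi> (W m \<omega>) * u (W m \<omega>))"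
        by (intro integrable_bounded[OF \<theta>, where B = "real N"]) auto
      have "\<bar>(?\<psi> w * u w) * min ((y - s)\<^sup>2) (real N)\<bar> \<le> real N * real N" for w y
        unfolding abs_mult[of "?\<psi> w * u w"] using le[of w] by (intro mult_mono) auto
      then show "integrable (P \<theta>) (\<lambda>\<omega>. ?\<psi> (W m \<omega>) * u (W m \<omega>) * min ((X (Suc m) \<omega> - s)\<^sup>2) (real N))"
        by (intro integrable_bounded[OF \<theta>, where B = "real N * real N"]) auto
    qed
    let ?u = falling and ?v = "\<lambda>w. 1 - falling w"
    have uv: "?u \<in> borel_measurable borel" "?v \<in> borel_measurable borel" by measurable
    have "?Z N \<omega> = (?\<psi> (W m \<omega>) * ?u (W m \<omega>)) * min ((X (Suc m) \<omega> - b)\<^sup>2) (real N) +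
        (?\<psi> (W m \<omega>) * ?v (W m \<omega>)) * min ((X (Suc m) \<omega> - a)\<^sup>2) (real N)" for \<omega>
      by (simp add: dev_def target_def falling_def)
    then have "(\<integral>\<omega>. ?Z N \<omega> \<partial>P \<theta>) =
        (\<integral>\<omega>. (?\<psi> (W m \<omega>) * ?u (W m \<omega>)) * min ((X (Suc m) \<omega> - b)\<^sup>2) (real N) \<partial>P \<theta>) +
        (\<integral>\<omega>. (?\<psi> (W m \<omega>) * ?v (W m \<omega>)) * min ((X (Suc m) \<omega> - a)\<^sup>2) (real N) \<partial>P \<theta>)"
      using int'[OF uv(1)] int'[OF uv(2)] falling_bounds by simp
    also have "\<dots> \<le> S * (\<integral>\<omega>. ?\<psi> (W m \<omega>) * ?u (W m \<omega>) \<partial>P \<theta>) + S * (\<integral>\<omega>. ?\<psi> (W m \<omega>) * ?v (W m \<omega>) \<partial>P \<theta>)"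
      using ramp_bounds ramp_tendsto continuous_ramp[OF continuous_dv]
      by (intro add_mono part[of b ramp falling] part[of a "\<lambda>k w. 1 - ramp k w"])
        (auto intro!: continuous_intros tendsto_intros)
    also have "\<dots> = S * ((\<integral>\<omega>. ?\<psi> (W m \<omega>) * ?u (W m \<omega>) \<partial>P \<theta>) + (\<integral>\<omega>. ?\<psi> (W m \<omega>) * ?v (W m \<omega>) \<partial>P \<theta>))"
      by (simp add: distrib_left)
    also have "\<dots> = S * (\<integral>\<omega>. ?\<psi> (W m \<omega>) * ?u (W m \<omega>) + ?\<psi> (W m \<omega>) * ?v (W m \<omega>) \<partial>P \<theta>)"
      using int[OF uv(1)] int[OF uv(2)] falling_bounds by simp
    finally show ?thesis by (simp add: algebra_simps)
  qed
  have nn: "(\<integral>\<^sup>+\<omega>. ennreal (?Z N \<omega>) \<partial>P \<theta>) \<le> ennreal S * (\<integral>\<^sup>+\<omega>. ennreal (\<psi> (W m \<omega>)) \<partial>P \<theta>)" for N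
  proof -
    have Zb: "\<bar>?Z N \<omega>\<bar> \<le> real N * real N" for \<omega>
      unfolding abs_mult using \<psi>(2)[of "W m \<omega>"] by (intro mult_mono) auto
    have "(\<integral>\<^sup>+\<omega>. ennreal (?Z N \<omega>) \<partial>P \<theta>) = ennreal (\<integral>\<omega>. ?Z N \<omega> \<partial>P \<theta>)"
      using Zb \<psi>(2) by (intro nn_integral_eq_integral integrable_bounded[OF \<theta>]) auto
    also have "\<dots> \<le> ennreal (S * (\<integral>\<omega>. min (\<psi> (W m \<omega>)) (real N) \<partial>P \<theta>))"
      using bound by (intro ennreal_leI)
    also have "\<dots> = ennreal S * ennreal (\<integral>\<omega>. min (\<psi> (W m \<omega>)) (real N) \<partial>P \<theta>)"
      using S0 by (rule ennreal_mult')
    also have "ennreal (\<integral>\<omega>. min (\<psi> (W m \<omega>)) (real N) \<partial>P \<theta>) = (\<integral>\<^sup>+\<omega>. ennreal (min (\<psi> (W m \<omega>)) (real N)) \<partial>P \<theta>)"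
      using \<psi>(2) by (intro nn_integral_eq_integral[symmetric] integrable_bounded[OF \<theta>, where B = "real N"]) auto
    also have "\<dots> \<le> (\<integral>\<^sup>+\<omega>. ennreal (\<psi> (W m \<omega>)) \<partial>P \<theta>)"
      by (intro nn_integral_mono ennreal_leI) simp
    finally show ?thesis by (simp add: mult_left_mono)
  qed
  have lim: "(\<lambda>N. ennreal (?Z N \<omega>)) \<longlonglongrightarrow> ennreal (\<psi> (W m \<omega>) * (dev m \<omega>)\<^sup>2)" for \<omega>
  proof -
    obtain N0 where N0: "max (\<psi> (W m \<omega>)) ((dev m \<omega>)\<^sup>2) \<le> real N0"
      using real_arch_simple by blast
    have "?Z N \<omega> = \<psi> (W m \<omega>) * (dev m \<omega>)\<^sup>2" if "N \<ge> N0" for N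
      using N0 that by (simp add: min_absorb1 order_trans[OF _ of_nat_mono[OF that]])
    then show ?thesis
      by (intro tendsto_eventually) (auto simp: eventually_sequentially intro!: exI[of _ N0])
  qed
  have "(\<integral>\<^sup>+\<omega>. ennreal (\<psi> (W m \<omega>) * (dev m \<omega>)\<^sup>2) \<partial>P \<theta>) =
      (\<integral>\<^sup>+\<omega>. liminf (\<lambda>N. ennreal (?Z N \<omega>)) \<partial>P \<theta>)"
    by (intro nn_integral_cong lim_imp_Liminf[OF _ lim, symmetric]) simp
  also have "\<dots> \<le> liminf (\<lambda>N. \<integral>\<^sup>+\<omega>. ennreal (?Z N \<omega>) \<partial>P \<theta>)"
    by (intro nn_integral_liminf measurable_P[OF \<theta>]) measurable
  also have "\<dots> \<le> ennreal S * (\<integral>\<^sup>+\<omega>. ennreal (\<psi> (W m \<omega>)) \<partial>P \<theta>)"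
    using nn by (intro Liminf_le always_eventually) auto
  finally show ?thesis .
qed

subsection \<open>Nearly optimal measures\<close>

text \<open>This is \<open>d w\<close> times the deviation of \<open>t y\<close> from the upper or
  lower mean of \<open>t (X 1)\<close>, chosen by the sign of \<open>d w\<close>. Written with
  positive and negative parts it is visibly continuous in \<open>w\<close> for continuous
  \<open>d\<close>: the mean switches only where the factor vanishes.\<close>

definition gain :: "(real \<Rightarrow> real) \<Rightarrow> (real \<Rightarrow> real) \<Rightarrow> real \<Rightarrow> real \<Rightarrow> real"
  where "gain d t w y = max 0 (d w) * (t y - EE (\<lambda>\<omega>. t (X 1 \<omega>))) +
    max 0 (- d w) * (- EE (\<lambda>\<omega>. - t (X 1 \<omega>)) - t y)"

context
  fixes d t :: "real \<Rightarrow> real" and R T :: real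
  assumes d: "continuous_on UNIV d" "\<And>w. \<bar>d w\<bar> \<le> R"
    and t: "continuous_on UNIV t" "\<And>y. \<bar>t y\<bar> \<le> T"
begin

lemma measurable_d_t [measurable]: "d \<in> borel_measurable borel" "t \<in> borel_measurable borel"
  using d(1) t(1) by (auto intro: borel_measurable_continuous_onI)

lemma gain_bound: "\<bar>gain d t w y\<bar> \<le> 2 * R * T"
proof -
  have "\<bar>EE (\<lambda>\<omega>. t (X 1 \<omega>))\<bar> \<le> T" "\<bar>EE (\<lambda>\<omega>. - t (X 1 \<omega>))\<bar> \<le> T"
    using t by (auto intro!: EE_bounded)
  then have "\<bar>t y - EE (\<lambda>\<omega>. t (X 1 \<omega>))\<bar> \<le> 2 * T" "\<bar>- EE (\<lambda>\<omega>. - t (X 1 \<omega>)) - t y\<bar> \<le> 2 * T"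
    using t(2)[of y] by linarith+
  then have "\<bar>d w\<bar> * \<bar>t y - EE (\<lambda>\<omega>. t (X 1 \<omega>))\<bar> \<le> R * (2 * T)"
    "\<bar>d w\<bar> * \<bar>- EE (\<lambda>\<omega>. - t (X 1 \<omega>)) - t y\<bar> \<le> R * (2 * T)"
    using d(2)[of w] by (intro mult_mono; linarith)+
  moreover have "0 \<le> R * T" using d(2)[of 0] t(2)[of 0] by (intro mult_nonneg_nonneg) linarith+
  ultimately show ?thesis
    by (cases "d w \<ge> 0") (simp_all add: gain_def abs_mult max_def del: minus_diff_eq)
qed

lemma measurable_gain [measurable]:
  "(\<lambda>\<omega>. gain d t (W m \<omega>) (X (Suc m) \<omega>)) \<in> borel_measurable M"
  unfolding gain_def by measurable

lemma integrable_gain: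
  assumes "\<theta> \<in> \<Theta>"
  shows "integrable (P \<theta>) (\<lambda>\<omega>. gain d t (W m \<omega>) (X (Suc m) \<omega>))"
  using assms gain_bound by (intro integrable_bounded) auto

text \<open>Each part of \<open>gain\<close> is a nonnegative weight times the excess of
  \<open>s * t\<close> over its sublinear expectation, with \<open>s = 1\<close> or
  \<open>s = -1\<close>; one inequality serves both means.\<close>

lemma integral_gain_le:
  assumes \<theta>: "\<theta> \<in> \<Theta>"
  shows "(\<integral>\<omega>. gain d t (W m \<omega>) (X (Suc m) \<omega>) \<partial>P \<theta>) \<le> 0"
proof -
  let ?\<psi> = "\<lambda>s w. max 0 (s * d w)" and ?h = "\<lambda>s y. s * t y"
  have d': "?\<psi> s w \<le> R" and t': "\<bar>?h s y\<bar> \<le> T" if "s \<in> {1, -1}" for s w y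
    using that d(2)[of w] t(2)[of y] by (auto simp: abs_le_iff)
  have part: "(\<integral>\<omega>. ?\<psi> s (W m \<omega>) * ?h s (X (Suc m) \<omega>) \<partial>P \<theta>) \<le>
      EE (\<lambda>\<omega>. ?h s (X 1 \<omega>)) * (\<integral>\<omega>. ?\<psi> s (W m \<omega>) \<partial>P \<theta>)" if "s \<in> {1, -1}" for s
    using d(1) t(1) d'[OF that] t'[OF that]
    by (intro integral_W_mult_le[OF \<theta>, where g = "\<lambda>_. ?\<psi> s" and c = R and T = T])
      (auto intro!: continuous_intros)
  have int: "integrable (P \<theta>) (\<lambda>\<omega>. ?\<psi> s (W m \<omega>))" if "s \<in> {1, -1}" for s
    using d'[OF that] by (intro integrable_bounded[OF \<theta>, where B = R]) (auto simp: abs_le_iff)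
  have int': "integrable (P \<theta>) (\<lambda>\<omega>. ?\<psi> s (W m \<omega>) * ?h s (X (Suc m) \<omega>))" if "s \<in> {1, -1}" for s
  proof (intro integrable_bounded[OF \<theta>, where B = "R * T"])
    have "0 \<le> R" using d(2)[of 0] by linarith
    then show "\<bar>?\<psi> s (W m \<omega>) * ?h s (X (Suc m) \<omega>)\<bar> \<le> R * T" for \<omega>
      using d'[OF that] t'[OF that] unfolding abs_mult[of "?\<psi> s (W m \<omega>)"] by (intro mult_mono) auto
  qed measurable
  have "(\<integral>\<omega>. gain d t (W m \<omega>) (X (Suc m) \<omega>) \<partial>P \<theta>) =
      (\<integral>\<omega>. (?\<psi> 1 (W m \<omega>) * ?h 1 (X (Suc m) \<omega>) - EE (\<lambda>\<omega>. ?h 1 (X 1 \<omega>)) * ?\<psi> 1 (W m \<omega>)) +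
        (?\<psi> (-1) (W m \<omega>) * ?h (-1) (X (Suc m) \<omega>) - EE (\<lambda>\<omega>. ?h (-1) (X 1 \<omega>)) * ?\<psi> (-1) (W m \<omega>)) \<partial>P \<theta>)"
    by (rule Bochner_Integration.integral_cong) (simp_all add: gain_def algebra_simps)
  also have "\<dots> = ((\<integral>\<omega>. ?\<psi> 1 (W m \<omega>) * ?h 1 (X (Suc m) \<omega>) \<partial>P \<theta>) -
        EE (\<lambda>\<omega>. ?h 1 (X 1 \<omega>)) * (\<integral>\<omega>. ?\<psi> 1 (W m \<omega>) \<partial>P \<theta>)) +
      ((\<integral>\<omega>. ?\<psi> (-1) (W m \<omega>) * ?h (-1) (X (Suc m) \<omega>) \<partial>P \<theta>) -
        EE (\<lambda>\<omega>. ?h (-1) (X 1 \<omega>)) * (\<integral>\<omega>. ?\<psi> (-1) (W m \<omega>) \<partial>P \<theta>))"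
    using int[of 1] int[of "-1"] int'[of 1] int'[of "-1"] by simp
  also have "\<dots> \<le> 0" using part[of 1] part[of "-1"] by simp
  finally show ?thesis .
qed

section \<open>The weighted score and its near maximisers\<close>

definition score :: "real \<Rightarrow> real \<Rightarrow> nat \<Rightarrow> 'a \<Rightarrow> real"
  where "score \<rho> \<epsilon> m \<omega> =
    (\<Sum>j=1..m. \<rho> ^ j * (gain d t (W (j - 1) \<omega>) (X j \<omega>) + \<epsilon> * falling (W (j - 1) \<omega>)))"

lemma score_Suc: "score \<rho> \<epsilon> (Suc m) \<omega> =
    score \<rho> \<epsilon> m \<omega> + \<rho> ^ Suc m * (gain d t (W m \<omega>) (X (Suc m) \<omega>) + \<epsilon> * falling (W m \<omega>))"
  by (simp add: score_def)

lemma measurable_score [measurable]: "score \<rho> \<epsilon> m \<in> borel_measurable M"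
proof (induction m)
  case (Suc m)
  note Suc[measurable]
  show ?case unfolding score_Suc[abs_def] by measurable
qed (simp add: score_def[abs_def])

lemma score_bounded: "\<exists>B. \<forall>\<omega>. \<bar>score \<rho> \<epsilon> m \<omega>\<bar> \<le> B"
proof (induction m)
  case (Suc m)
  then obtain B where B: "\<And>\<omega>. \<bar>score \<rho> \<epsilon> m \<omega>\<bar> \<le> B" by auto
  have "\<bar>score \<rho> \<epsilon> (Suc m) \<omega>\<bar> \<le> B + \<bar>\<rho> ^ Suc m\<bar> * (2 * R * T + \<bar>\<epsilon>\<bar>)" for \<omega>
  proof -
    have "\<bar>\<epsilon> * falling (W m \<omega>)\<bar> \<le> \<bar>\<epsilon>\<bar>" by (simp add: falling_def)
    then have "\<bar>gain d t (W m \<omega>) (X (Suc m) \<omega>) + \<epsilon> * falling (W m \<omega>)\<bar> \<le> 2 * R * T + \<bar>\<epsilon>\<bar>"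
      using gain_bound[of "W m \<omega>" "X (Suc m) \<omega>"] by linarith
    then have "\<bar>\<rho> ^ Suc m * (gain d t (W m \<omega>) (X (Suc m) \<omega>) + \<epsilon> * falling (W m \<omega>))\<bar> \<le>
        \<bar>\<rho> ^ Suc m\<bar> * (2 * R * T + \<bar>\<epsilon>\<bar>)"
      unfolding abs_mult by (rule mult_left_mono) simp
    then show ?thesis unfolding score_Suc using B[of \<omega>] by linarith
  qed
  then show ?case by blast
qed (simp add: score_def, blast)

lemma integrable_score: "\<theta> \<in> \<Theta> \<Longrightarrow> integrable (P \<theta>) (score \<rho> \<epsilon> m)"
  using score_bounded[of \<rho> \<epsilon> m] by (auto intro: integrable_bounded)

text \<open>
  Independence only applies to continuous functions of the past, and \<open>score\<close> is discontinuous
  where \<open>dv\<close> vanishes. The bonus \<open>\<epsilon> * falling\<close> outweighs all later terms, so \<open>score\<close> is the limit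
  from below of continuous blends, and for this inequality a lower approximation is enough.
\<close>

lemma EE_score_Suc_ge:
  assumes \<rho>: "0 < \<rho>" "\<rho> < 1" and \<epsilon>: "0 < \<epsilon>" and small: "\<rho> * (2 * (2 * R * T) + 3 * \<epsilon>) \<le> \<epsilon>" and \<theta>: "\<theta> \<in> \<Theta>"
  shows "(\<integral>\<omega>. score \<rho> \<epsilon> m \<omega> + \<rho> ^ Suc m * (\<epsilon> * falling (W m \<omega>)) \<partial>P \<theta>) \<le> EE (score \<rho> \<epsilon> (Suc m))"
proof -
  define p where "p = EE (\<lambda>\<omega>. t (X 1 \<omega>))"
  define q where "q = - EE (\<lambda>\<omega>. - t (X 1 \<omega>))"
  define J where "J = 2 * R * T"
  have J: "0 \<le> J" "\<bar>gain d t w y\<bar> \<le> J" for w y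
    using gain_bound[of w y] abs_ge_zero[of "gain d t w y"] unfolding J_def by linarith+
  define c where "c \<gamma> = (\<lambda>j w y. \<rho> ^ j * (gain d t w y + \<epsilon> * \<gamma> w))" for \<gamma>
  \<comment> \<open>\<open>B\<close> and \<open>C\<close> carry the coefficients of
    \<open>t y - p\<close> and \<open>q - t y\<close> in the next gain. The next bonus is determined
    by the past and therefore belongs to \<open>A\<close>.\<close>
  define A where "A \<gamma> = blend (c \<gamma>) (\<lambda>w. \<rho> ^ Suc m * (\<epsilon> * \<gamma> w)) \<gamma> m 1 0" for \<gamma>
  define B where "B \<gamma> = blend (\<lambda>_ _ _. 0) (\<lambda>w. \<rho> ^ Suc m * max 0 (d w)) \<gamma> m 1 0" for \<gamma>
  define C where "C \<gamma> = blend (\<lambda>_ _ _. 0) (\<lambda>w. \<rho> ^ Suc m * max 0 (- d w)) \<gamma> m 1 0" for \<gamma>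
  let ?F = "\<lambda>\<gamma> z y. A \<gamma> z + B \<gamma> z * (t y - p) + C \<gamma> z * (q - t y)"
  let ?Z = "\<lambda>\<gamma> z. A \<gamma> z - min (B \<gamma> z) (C \<gamma> z) * (p - q)"
  have F: "?F \<gamma> z y = blend (c \<gamma>) (\<lambda>w. \<rho> ^ Suc m * (gain d t w y + \<epsilon> * \<gamma> w)) \<gamma> m 1 0 z" for \<gamma> z y
  proof -
    have "(\<lambda>w. \<rho> ^ Suc m * (gain d t w y + \<epsilon> * \<gamma> w)) = (\<lambda>w. \<rho> ^ Suc m * (\<epsilon> * \<gamma> w) +
        (t y - p) * (\<rho> ^ Suc m * max 0 (d w)) + (q - t y) * (\<rho> ^ Suc m * max 0 (- d w)))"
      by (rule ext) (simp add: gain_def p_def q_def algebra_simps)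
    then show ?thesis
      by (simp only: blend_terminal A_def B_def C_def mult.commute)
  qed
  \<comment> \<open>One constant for all blends: running costs are at most
    \<open>J + \<epsilon>\<close>, terminal costs at most \<open>\<epsilon>\<close> or
    \<open>R\<close>, before weighting.\<close>
  define K where "K = J + \<epsilon> + R"
  have R0: "0 \<le> R" using d(2)[of 0] by linarith
  have cbound: "\<bar>c (ramp k) j w y\<bar> \<le> K * \<rho> ^ j"
    and \<tau>bound: "\<bar>\<rho> ^ j * (\<epsilon> * ramp k w)\<bar> \<le> K * \<rho> ^ j" "\<bar>\<rho> ^ j * max 0 (d w)\<bar> \<le> K * \<rho> ^ j"
      "\<bar>\<rho> ^ j * max 0 (- d w)\<bar> \<le> K * \<rho> ^ j" for k j w y
  proof -
    have r: "\<bar>\<rho> ^ j * u\<bar> \<le> K * \<rho> ^ j" if "\<bar>u\<bar> \<le> K" for u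
      using that \<rho> by (simp add: abs_mult mult.commute)
    have e: "0 \<le> \<epsilon> * ramp k w" "\<epsilon> * ramp k w \<le> \<epsilon>"
      using \<epsilon> ramp_bounds[of k w] by (auto simp: mult_left_le)
    show "\<bar>c (ramp k) j w y\<bar> \<le> K * \<rho> ^ j"
      unfolding c_def using e J(2)[of w y] R0 by (intro r) (simp add: K_def)
    show "\<bar>\<rho> ^ j * (\<epsilon> * ramp k w)\<bar> \<le> K * \<rho> ^ j"
      using e J(1) R0 by (intro r) (simp add: K_def)
    show "\<bar>\<rho> ^ j * max 0 (d w)\<bar> \<le> K * \<rho> ^ j" "\<bar>\<rho> ^ j * max 0 (- d w)\<bar> \<le> K * \<rho> ^ j"
      using d(2)[of w] J(1) \<epsilon> by (intro r; simp add: K_def abs_le_iff)+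
  qed
  have K0: "0 \<le> K" using J(1) \<epsilon> R0 by (simp add: K_def)
  define b0 where "b0 = K * \<rho> ^ 1 / (1 - \<rho>)"
  have bound: "\<bar>A (ramp k) z\<bar> \<le> b0" "\<bar>B (ramp k) z\<bar> \<le> b0" "\<bar>C (ramp k) z\<bar> \<le> b0" for k z
    unfolding A_def B_def C_def b0_def using ramp_bounds \<rho> K0 cbound \<tau>bound
    by (intro blend_bound; simp add: mult_nonneg_nonneg del: power_Suc)+
  have BC0: "0 \<le> B (ramp k) z" "0 \<le> C (ramp k) z" for k z
    unfolding B_def C_def using ramp_bounds \<rho> by (intro blend_nonneg; simp)+
  have b00: "0 \<le> b0" using bound(2)[of 0 "\<lambda>_. 0"] by linarith
  have gain_pair: "(\<lambda>(w, y). c (ramp k) j w y) \<in> borel_measurable (borel \<Otimes>\<^sub>M borel)" for k j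
    unfolding c_def gain_def by measurable
  have meas [measurable]: "(\<lambda>\<omega>. A (ramp k) (history m \<omega>)) \<in> borel_measurable M"
    "(\<lambda>\<omega>. B (ramp k) (history m \<omega>)) \<in> borel_measurable M"
    "(\<lambda>\<omega>. C (ramp k) (history m \<omega>)) \<in> borel_measurable M" for k
    unfolding A_def B_def C_def by (intro measurable_blend_history gain_pair; measurable)+
  note cont_ramp = continuous_ramp[OF continuous_dv]
  have cont: "continuous_map (powertop_real {1..m}) euclideanreal (A (ramp k))"
    "continuous_map (powertop_real {1..m}) euclideanreal (B (ramp k))"
    "continuous_map (powertop_real {1..m}) euclideanreal (C (ramp k))" for k
  proof -
    have comp: "continuous_map T' euclideanreal (\<lambda>z. c (ramp k) j (g z) (h z))"
      if "continuous_map T' euclideanreal g" "continuous_map T' euclideanreal h" for T' :: "(nat \<Rightarrow> real) topology" and j g h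
    proof -
      have "continuous_on UNIV (\<lambda>w. max 0 (d w))" "continuous_on UNIV (\<lambda>w. max 0 (- d w))"
        using d(1) by (auto intro!: continuous_intros)
      then show ?thesis
        unfolding c_def gain_def
        using that continuous_map_real_comp[OF d(1) that(1)] continuous_map_real_comp[OF t(1) that(2)]
          continuous_map_real_comp[OF cont_ramp that(1)]
        by (auto intro!: continuous_intros)
    qed
    show "continuous_map (powertop_real {1..m}) euclideanreal (A (ramp k))"
      unfolding A_def using cont_ramp by (intro continuous_map_blend_history comp) (auto intro!: continuous_intros)
    show "continuous_map (powertop_real {1..m}) euclideanreal (B (ramp k))"
      "continuous_map (powertop_real {1..m}) euclideanreal (C (ramp k))"
      unfolding B_def C_def using cont_ramp d(1)
      by (intro continuous_map_blend_history; auto intro!: continuous_intros)+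
  qed
  have score: "score \<rho> \<epsilon> (Suc m) \<omega> =
      blend (c falling) (\<lambda>w. \<rho> ^ Suc m * (gain d t w (X (Suc m) \<omega>) + \<epsilon> * falling w)) falling m 1 0 (\<lambda>j. X j \<omega>)" for \<omega>
    unfolding blend_falling_start by (simp add: score_def c_def W_def)
  have below: "?F (ramp k) (history m \<omega>) (X (Suc m) \<omega>) \<le> score \<rho> \<epsilon> (Suc m) \<omega>" for k \<omega>
    unfolding F score blend_history c_def
    using blend_ramp_le[OF \<rho>(1) \<epsilon> J(1) small[folded J_def] J(2), where i = 1 and r = m] by simp
  have Zbound: "\<bar>?Z (ramp k) z\<bar> \<le> b0 + b0 * \<bar>p - q\<bar>" for k z
  proof -
    have "\<bar>min (B (ramp k) z) (C (ramp k) z) * (p - q)\<bar> \<le> b0 * \<bar>p - q\<bar>"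
      unfolding abs_mult using bound(2,3)[of k z] by (intro mult_right_mono) auto
    then show ?thesis using bound(1)[of k z] by linarith
  qed
  have step: "(\<integral>\<omega>. ?Z (ramp k) (history m \<omega>) \<partial>P \<theta>) \<le> EE (score \<rho> \<epsilon> (Suc m))" for k
  proof -
    have "(\<integral>\<omega>. ?Z (ramp k) (history m \<omega>) \<partial>P \<theta>) \<le> EE (\<lambda>\<omega>. ?Z (ramp k) (history m \<omega>))"
      using Zbound by (intro integral_le_EE[OF \<theta>]) auto
    also have "\<dots> = EE (\<lambda>\<omega>. ?F (ramp k) (history m \<omega>) (X (Suc m) \<omega>))"
      by (rule EE_independent_affine[OF cont bound t p_def q_def, symmetric])
    also have "\<dots> \<le> EE (score \<rho> \<epsilon> (Suc m))"
    proof -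
      obtain B' where B': "\<And>\<omega>. \<bar>score \<rho> \<epsilon> (Suc m) \<omega>\<bar> \<le> B'" using score_bounded by blast
      have "\<bar>?F (ramp k) z y\<bar> \<le> b0 + b0 * (T + \<bar>p\<bar>) + b0 * (\<bar>q\<bar> + T)" for z y
      proof -
        have "\<bar>B (ramp k) z * (t y - p)\<bar> \<le> b0 * (T + \<bar>p\<bar>)" "\<bar>C (ramp k) z * (q - t y)\<bar> \<le> b0 * (\<bar>q\<bar> + T)"
          unfolding abs_mult using bound(2,3)[of k z] t(2)[of y] by (intro mult_mono; linarith)+
        then show ?thesis using bound(1)[of k z] by linarith
      qed
      then show ?thesis
        using below B' by (intro EE_mono[where B = "b0 + b0 * (T + \<bar>p\<bar>) + b0 * (\<bar>q\<bar> + T)" and B' = B']) auto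
    qed
    finally show ?thesis .
  qed
  have "(\<lambda>k. \<integral>\<omega>. ?Z (ramp k) (history m \<omega>) \<partial>P \<theta>) \<longlonglongrightarrow>
      (\<integral>\<omega>. score \<rho> \<epsilon> m \<omega> + \<rho> ^ Suc m * (\<epsilon> * falling (W m \<omega>)) \<partial>P \<theta>)"
  proof (rule integral_dominated_convergence)
    interpret prob_space "P \<theta>" using \<theta> by (rule prob_space_P)
    show "integrable (P \<theta>) (\<lambda>_. b0 + b0 * \<bar>p - q\<bar>)" by simp
    show "AE \<omega> in P \<theta>. norm (?Z (ramp k) (history m \<omega>)) \<le> b0 + b0 * \<bar>p - q\<bar>" for k
      using Zbound by simp
    have "(\<lambda>k. ?Z (ramp k) (history m \<omega>)) \<longlonglongrightarrow>
        score \<rho> \<epsilon> m \<omega> + \<rho> ^ Suc m * (\<epsilon> * falling (W m \<omega>))" for \<omega>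
    proof -
      have "(\<lambda>k. ?Z (ramp k) (history m \<omega>)) \<longlonglongrightarrow> ?Z falling (history m \<omega>)"
        unfolding A_def B_def C_def c_def
        by (intro tendsto_intros blend_tendsto ramp_tendsto)
      moreover have "B falling (history m \<omega>) = \<rho> ^ Suc m * max 0 (d (W m \<omega>))"
        "C falling (history m \<omega>) = \<rho> ^ Suc m * max 0 (- d (W m \<omega>))"
        unfolding B_def C_def blend_history blend_terminal_falling by simp_all
      \<comment> \<open>Without blending there is a single final state, and the positive and
        negative part of \<open>d\<close> there cannot both be nonzero: the subtracted term
        disappears in the limit.\<close>
      moreover have "min (\<rho> ^ Suc m * max 0 (d (W m \<omega>))) (\<rho> ^ Suc m * max 0 (- d (W m \<omega>))) = 0"
        using \<rho> by (cases "d (W m \<omega>) \<ge> 0") (simp_all add: min_absorb1 min_absorb2 mult_nonneg_nonpos)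
      moreover have "A falling (history m \<omega>) = score \<rho> \<epsilon> m \<omega> + \<rho> ^ Suc m * (\<epsilon> * falling (W m \<omega>))"
        unfolding A_def blend_history blend_falling_start by (simp add: score_def c_def W_def)
      ultimately show ?thesis by simp
    qed
    then show "AE \<omega> in P \<theta>. (\<lambda>k. ?Z (ramp k) (history m \<omega>)) \<longlonglongrightarrow>
        score \<rho> \<epsilon> m \<omega> + \<rho> ^ Suc m * (\<epsilon> * falling (W m \<omega>))" by simp
  qed (auto intro!: measurable_P[OF \<theta>])
  then show ?thesis by (rule LIMSEQ_le_const2) (use step in auto)
qed

text \<open>
  A near maximiser of \<open>score\<close> is nearly optimal at each step: the weights \<open>\<rho> ^ j\<close> decrease so fast
  that no loss in \<open>gain\<close> at one step can be made up for by the bonuses of the later steps.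
\<close>

lemma near_optimal_gain:
  assumes "0 < \<epsilon>"
  shows "\<exists>\<theta>\<in>\<Theta>. \<forall>m<N. - (\<epsilon> * real N) \<le> (\<integral>\<omega>. gain d t (W m \<omega>) (X (Suc m) \<omega>) \<partial>P \<theta>)"
proof -
  define J where "J = 2 * R * T"
  have J: "0 \<le> J"
    using gain_bound[of 0 0] abs_ge_zero[of "gain d t 0 0"] unfolding J_def by linarith
  \<comment> \<open>Equality in the condition of \<open>EE_score_Suc_ge\<close>.\<close>
  define \<rho> where "\<rho> = \<epsilon> / (2 * J + 3 * \<epsilon>)"
  have \<rho>: "0 < \<rho>" "\<rho> < 1" "\<rho> * (2 * (2 * R * T) + 3 * \<epsilon>) \<le> \<epsilon>"
    using assms J unfolding \<rho>_def J_def[symmetric] by (auto simp: divide_less_eq)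
  let ?s = "score \<rho> \<epsilon>"
  \<comment> \<open>The slack must be small even against the last and smallest weight
    \<open>\<rho> ^ N\<close>.\<close>
  have "\<exists>\<theta>\<in>\<Theta>. EE (?s N) - \<epsilon> * \<rho> ^ N \<le> (\<integral>\<omega>. ?s N \<omega> \<partial>P \<theta>)"
  proof (rule ccontr)
    assume "\<not> ?thesis"
    then have "EE (?s N) \<le> EE (?s N) - \<epsilon> * \<rho> ^ N" by (intro EE_le) force
    then show False using assms \<rho>(1) by (simp add: mult_le_0_iff not_less[symmetric])
  qed
  then obtain \<theta> where \<theta>: "\<theta> \<in> \<Theta>" "EE (?s N) - \<epsilon> * \<rho> ^ N \<le> (\<integral>\<omega>. ?s N \<omega> \<partial>P \<theta>)" by blast
  interpret prob_space "P \<theta>" using \<theta>(1) by (rule prob_space_P)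
  let ?g = "\<lambda>m. \<integral>\<omega>. gain d t (W m \<omega>) (X (Suc m) \<omega>) \<partial>P \<theta>"
  let ?f = "\<lambda>m. \<integral>\<omega>. falling (W m \<omega>) \<partial>P \<theta>"
  have fint: "integrable (P \<theta>) (\<lambda>\<omega>. falling (W m \<omega>))" for m
    using \<theta>(1) by (intro integrable_bounded[where B = 1]) (auto simp: falling_def)
  have f: "0 \<le> ?f m" "?f m \<le> 1" for m
    using falling_bounds fint by (auto intro!: integral_nonneg_AE integral_le_const)
  have bonus: "0 \<le> \<rho> ^ Suc m * (\<epsilon> * ?f m)" "\<rho> ^ Suc m * (\<epsilon> * ?f m) \<le> \<rho> ^ Suc m * \<epsilon>" for m
    using f[of m] \<rho>(1) assms by (auto simp: mult_left_le)
  have sSuc: "(\<integral>\<omega>. ?s (Suc m) \<omega> \<partial>P \<theta>) = (\<integral>\<omega>. ?s m \<omega> \<partial>P \<theta>) + \<rho> ^ Suc m * (\<epsilon> * ?f m) + \<rho> ^ Suc m * ?g m" for m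
    unfolding score_Suc using integrable_score[OF \<theta>(1)] integrable_gain[OF \<theta>(1)] fint
    by (simp add: algebra_simps)
  have key: "(\<integral>\<omega>. ?s m \<omega> \<partial>P \<theta>') + \<rho> ^ Suc m * (\<epsilon> * (\<integral>\<omega>. falling (W m \<omega>) \<partial>P \<theta>')) \<le> EE (?s (Suc m))"
    if "\<theta>' \<in> \<Theta>" for m \<theta>'
  proof -
    have "integrable (P \<theta>') (\<lambda>\<omega>. falling (W m \<omega>))"
      using that by (intro integrable_bounded[where B = 1]) (auto simp: falling_def)
    then show ?thesis
      using EE_score_Suc_ge[OF \<rho>(1,2) assms \<rho>(3) that, of m] integrable_score[OF that] by simp
  qed
  have mono: "EE (?s m) \<le> EE (?s (Suc m))" for m
  proof (rule EE_le)
    fix \<theta>' assume \<theta>': "\<theta>' \<in> \<Theta>"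
    have "0 \<le> (\<integral>\<omega>. falling (W m \<omega>) \<partial>P \<theta>')" using falling_bounds by (auto intro!: integral_nonneg_AE)
    then have "0 \<le> \<rho> ^ Suc m * (\<epsilon> * (\<integral>\<omega>. falling (W m \<omega>) \<partial>P \<theta>'))" using \<rho>(1) assms by simp
    then show "(\<integral>\<omega>. ?s m \<omega> \<partial>P \<theta>') \<le> EE (?s (Suc m))" using key[OF \<theta>', of m] by linarith
  qed
  \<comment> \<open>Backwards from \<open>N\<close>: the gain is nonpositive, so going from
    \<open>Suc m\<close> to \<open>m\<close> loses at most the bonus
    \<open>\<rho> ^ Suc m * \<epsilon>\<close>. This adds one unit to the count, and
    \<open>\<rho> < 1\<close> lets the slack be restated with the weight
    \<open>\<rho> ^ m\<close>.\<close>
  have near: "EE (?s m) - \<epsilon> * \<rho> ^ m * (real N - real m + 1) \<le> (\<integral>\<omega>. ?s m \<omega> \<partial>P \<theta>)" if "m \<le> N" for m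
    using that
  proof (induction rule: inc_induct)
    case base
    then show ?case using \<theta>(2) by simp
  next
    case (step m)
    have "\<rho> ^ Suc m * ?g m \<le> 0"
      using integral_gain_le[OF \<theta>(1), of m] \<rho>(1) by (intro mult_nonneg_nonpos) auto
    then have "EE (?s m) - (\<epsilon> * \<rho> ^ Suc m * (real N - real (Suc m) + 1) + \<rho> ^ Suc m * \<epsilon>) \<le> (\<integral>\<omega>. ?s m \<omega> \<partial>P \<theta>)"
      using step.IH mono[of m] sSuc[of m] bonus[of m] by linarith
    moreover have "\<epsilon> * \<rho> ^ Suc m * (real N - real (Suc m) + 1) + \<rho> ^ Suc m * \<epsilon> =
        \<rho> * (\<epsilon> * \<rho> ^ m * (real N - real m + 1))" by (simp add: algebra_simps)
    moreover have "\<rho> * (\<epsilon> * \<rho> ^ m * (real N - real m + 1)) \<le> \<epsilon> * \<rho> ^ m * (real N - real m + 1)"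
      using \<rho> assms step.hyps by (intro mult_left_le_one_le) auto
    ultimately show ?case by linarith
  qed
  show ?thesis
  proof (rule bexI[OF _ \<theta>(1)], intro allI impI)
    fix m assume m: "m < N"
    \<comment> \<open>\<open>key\<close> is used for the same \<theta>, so the bonus of this step
      cancels and only the gain is left to account for the slack.\<close>
    have "\<rho> ^ Suc m * (- (\<epsilon> * (real N - real m))) \<le> \<rho> ^ Suc m * ?g m"
      using near[of "Suc m"] key[OF \<theta>(1), of m] sSuc[of m] m by (simp add: algebra_simps)
    then have "- (\<epsilon> * (real N - real m)) \<le> ?g m"
      using \<rho>(1) by (subst (asm) mult_le_cancel_left_pos) auto
    moreover have "\<epsilon> * (real N - real m) \<le> \<epsilon> * real N" using assms by simp
    ultimately show "- (\<epsilon> * real N) \<le> ?g m" by linarith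
  qed
qed

end

subsection \<open>Removing the truncation\<close>

lemma integral_square_dev_le:
  assumes \<theta>: "\<theta> \<in> \<Theta>" and \<psi>: "continuous_on UNIV \<psi>" "\<And>w. 0 \<le> \<psi> w" "integrable (P \<theta>) (\<lambda>\<omega>. \<psi> (W m \<omega>))"
  shows "integrable (P \<theta>) (\<lambda>\<omega>. \<psi> (W m \<omega>) * (dev m \<omega>)\<^sup>2)"
    and "(\<integral>\<omega>. \<psi> (W m \<omega>) * (dev m \<omega>)\<^sup>2 \<partial>P \<theta>) \<le> S * (\<integral>\<omega>. \<psi> (W m \<omega>) \<partial>P \<theta>)"
proof -
  have [measurable]: "\<psi> \<in> borel_measurable borel"
    using \<psi>(1) by (rule borel_measurable_continuous_onI)
  have \<psi>0: "0 \<le> (\<integral>\<omega>. \<psi> (W m \<omega>) \<partial>P \<theta>)" using \<psi>(2) by (simp add: integral_nonneg_AE)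
  have "(\<integral>\<^sup>+\<omega>. ennreal (\<psi> (W m \<omega>)) \<partial>P \<theta>) = ennreal (\<integral>\<omega>. \<psi> (W m \<omega>) \<partial>P \<theta>)"
    using \<psi>(2,3) by (intro nn_integral_eq_integral) auto
  then have le: "(\<integral>\<^sup>+\<omega>. ennreal (\<psi> (W m \<omega>) * (dev m \<omega>)\<^sup>2) \<partial>P \<theta>) \<le> ennreal (S * (\<integral>\<omega>. \<psi> (W m \<omega>) \<partial>P \<theta>))"
    using nn_integral_square_dev_le[OF \<theta> \<psi>(1,2), of m] S_nonneg by (simp add: ennreal_mult')
  show int: "integrable (P \<theta>) (\<lambda>\<omega>. \<psi> (W m \<omega>) * (dev m \<omega>)\<^sup>2)"
    using le \<psi>(2) by (intro integrableI_nonneg measurable_P[OF \<theta>]) (auto simp: less_top[symmetric] top_unique)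
  have "ennreal (\<integral>\<omega>. \<psi> (W m \<omega>) * (dev m \<omega>)\<^sup>2 \<partial>P \<theta>) \<le> ennreal (S * (\<integral>\<omega>. \<psi> (W m \<omega>) \<partial>P \<theta>))"
    using le \<psi>(2) int by (subst nn_integral_eq_integral[symmetric]) auto
  then show "(\<integral>\<omega>. \<psi> (W m \<omega>) * (dev m \<omega>)\<^sup>2 \<partial>P \<theta>) \<le> S * (\<integral>\<omega>. \<psi> (W m \<omega>) \<partial>P \<theta>)"
    using S_nonneg \<psi>0 by (subst (asm) ennreal_le_iff) auto
qed

lemma square_dev:
  assumes "\<theta> \<in> \<Theta>"
  shows "integrable (P \<theta>) (\<lambda>\<omega>. (dev m \<omega>)\<^sup>2)" and "(\<integral>\<omega>. (dev m \<omega>)\<^sup>2 \<partial>P \<theta>) \<le> S"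
proof -
  interpret prob_space "P \<theta>" using assms by (rule prob_space_P)
  show "integrable (P \<theta>) (\<lambda>\<omega>. (dev m \<omega>)\<^sup>2)" "(\<integral>\<omega>. (dev m \<omega>)\<^sup>2 \<partial>P \<theta>) \<le> S"
    using integral_square_dev_le[OF assms, of "\<lambda>_. 1" m] by (simp_all add: prob_space)
qed

text \<open>Crude growth is harmless, since \<open>m\<close> stays fixed while the truncation levels
  grow; only uniformity in \<theta> matters. The factor 4 absorbs the two terms of size
  \<open>2 * 4 ^ m * (S / \<nu>\<^sup>2)\<close>.\<close>

lemma square_W:
  assumes "\<theta> \<in> \<Theta>"
  shows "integrable (P \<theta>) (\<lambda>\<omega>. (W m \<omega>)\<^sup>2)" and "(\<integral>\<omega>. (W m \<omega>)\<^sup>2 \<partial>P \<theta>) \<le> 4 ^ m * (S / \<nu>\<^sup>2)"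
proof -
  have "integrable (P \<theta>) (\<lambda>\<omega>. (W m \<omega>)\<^sup>2) \<and> (\<integral>\<omega>. (W m \<omega>)\<^sup>2 \<partial>P \<theta>) \<le> 4 ^ m * (S / \<nu>\<^sup>2)"
  proof (induction m)
    case 0
    then show ?case using S_nonneg by (simp add: W_0)
  next
    case (Suc m)
    have le: "(W (Suc m) \<omega>)\<^sup>2 \<le> 2 * (W m \<omega>)\<^sup>2 + 2 / \<nu>\<^sup>2 * (dev m \<omega>)\<^sup>2" for \<omega>
      using sum_square_le[of "W m \<omega>" "dev m \<omega> / \<nu>"] by (simp add: W_Suc power_divide)
    have int: "integrable (P \<theta>) (\<lambda>\<omega>. 2 * (W m \<omega>)\<^sup>2 + 2 / \<nu>\<^sup>2 * (dev m \<omega>)\<^sup>2)"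
      using Suc square_dev[OF assms] by auto
    have int': "integrable (P \<theta>) (\<lambda>\<omega>. (W (Suc m) \<omega>)\<^sup>2)"
      using le by (intro Bochner_Integration.integrable_bound[OF int] measurable_P[OF assms]) auto
    have "(\<integral>\<omega>. (W (Suc m) \<omega>)\<^sup>2 \<partial>P \<theta>) \<le> (\<integral>\<omega>. 2 * (W m \<omega>)\<^sup>2 + 2 / \<nu>\<^sup>2 * (dev m \<omega>)\<^sup>2 \<partial>P \<theta>)"
      using int int' le by (intro integral_mono)
    also have "\<dots> = 2 * (\<integral>\<omega>. (W m \<omega>)\<^sup>2 \<partial>P \<theta>) + 2 / \<nu>\<^sup>2 * (\<integral>\<omega>. (dev m \<omega>)\<^sup>2 \<partial>P \<theta>)"
      using Suc square_dev[OF assms] by simp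
    also have "\<dots> \<le> 2 * (4 ^ m * (S / \<nu>\<^sup>2)) + 2 / \<nu>\<^sup>2 * S"
      using Suc square_dev(2)[OF assms, of m] by (intro add_mono mult_left_mono) auto
    also have "2 / \<nu>\<^sup>2 * S \<le> 2 * (4 ^ m * (S / \<nu>\<^sup>2))"
    proof -
      have "1 * (S / \<nu>\<^sup>2) \<le> 4 ^ m * (S / \<nu>\<^sup>2)" using S_nonneg by (intro mult_right_mono) auto
      then show ?thesis by simp
    qed
    finally show ?case using int' by (simp add: algebra_simps)
  qed
  then show "integrable (P \<theta>) (\<lambda>\<omega>. (W m \<omega>)\<^sup>2)" and "(\<integral>\<omega>. (W m \<omega>)\<^sup>2 \<partial>P \<theta>) \<le> 4 ^ m * (S / \<nu>\<^sup>2)" by auto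
qed

text \<open>Identical distribution is tested on bounded functions only and does not transfer second
  moments directly. They are recovered from \<open>dev m\<close> by adding back the bounded
  centering.\<close>

lemma square_X:
  assumes \<theta>: "\<theta> \<in> \<Theta>"
  shows "integrable (P \<theta>) (\<lambda>\<omega>. (X (Suc m) \<omega>)\<^sup>2)"
    and "(\<integral>\<omega>. (X (Suc m) \<omega>)\<^sup>2 \<partial>P \<theta>) \<le> 2 * S + 2 * (\<bar>a\<bar> + \<bar>b\<bar>)\<^sup>2"
proof -
  interpret prob_space "P \<theta>" using \<theta> by (rule prob_space_P)
  have le: "(X (Suc m) \<omega>)\<^sup>2 \<le> 2 * (dev m \<omega>)\<^sup>2 + 2 * (\<bar>a\<bar> + \<bar>b\<bar>)\<^sup>2" for \<omega>
  proof -
    have "(target (W m \<omega>))\<^sup>2 \<le> (\<bar>a\<bar> + \<bar>b\<bar>)\<^sup>2"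
      using target_le[of "W m \<omega>"] by (simp add: abs_le_square_iff[symmetric])
    then show ?thesis
      using sum_square_le[of "dev m \<omega>" "target (W m \<omega>)"] by (simp add: dev_def)
  qed
  have int: "integrable (P \<theta>) (\<lambda>\<omega>. 2 * (dev m \<omega>)\<^sup>2 + 2 * (\<bar>a\<bar> + \<bar>b\<bar>)\<^sup>2)"
    using square_dev[OF \<theta>] by auto
  show int': "integrable (P \<theta>) (\<lambda>\<omega>. (X (Suc m) \<omega>)\<^sup>2)"
    using le by (intro Bochner_Integration.integrable_bound[OF int] measurable_P[OF \<theta>]) auto
  have "(\<integral>\<omega>. (X (Suc m) \<omega>)\<^sup>2 \<partial>P \<theta>) \<le> (\<integral>\<omega>. 2 * (dev m \<omega>)\<^sup>2 + 2 * (\<bar>a\<bar> + \<bar>b\<bar>)\<^sup>2 \<partial>P \<theta>)"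
    using int int' le by (intro integral_mono)
  also have "\<dots> = 2 * (\<integral>\<omega>. (dev m \<omega>)\<^sup>2 \<partial>P \<theta>) + 2 * (\<bar>a\<bar> + \<bar>b\<bar>)\<^sup>2"
    using square_dev[OF \<theta>, of m] by (simp add: prob_space)
  finally show "(\<integral>\<omega>. (X (Suc m) \<omega>)\<^sup>2 \<partial>P \<theta>) \<le> 2 * S + 2 * (\<bar>a\<bar> + \<bar>b\<bar>)\<^sup>2"
    using square_dev(2)[OF \<theta>, of m] by linarith
qed

lemma square_dv_W:
  assumes "\<theta> \<in> \<Theta>"
  shows "integrable (P \<theta>) (\<lambda>\<omega>. (dv (W m \<omega>))\<^sup>2)"
    and "(\<integral>\<omega>. (dv (W m \<omega>))\<^sup>2 \<partial>P \<theta>) \<le> 2 * (dv 0)\<^sup>2 + 2 * L\<^sup>2 * (4 ^ m * (S / \<nu>\<^sup>2))"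
proof -
  interpret prob_space "P \<theta>" using assms by (rule prob_space_P)
  have le: "(dv w)\<^sup>2 \<le> 2 * L\<^sup>2 * w\<^sup>2 + 2 * (dv 0)\<^sup>2" for w
  proof -
    have "\<bar>dv w - dv 0\<bar> \<le> \<bar>L * w\<bar>"
      using lipschitz_onD[OF lipschitz_dv, of w 0] lipschitz_on_nonneg[OF lipschitz_dv]
      by (simp add: dist_real_def abs_mult)
    then have "(dv w - dv 0)\<^sup>2 \<le> L\<^sup>2 * w\<^sup>2"
      by (simp add: abs_le_square_iff power_mult_distrib)
    then show ?thesis using sum_square_le[of "dv w - dv 0" "dv 0"] by simp
  qed
  have int: "integrable (P \<theta>) (\<lambda>\<omega>. 2 * L\<^sup>2 * (W m \<omega>)\<^sup>2 + 2 * (dv 0)\<^sup>2)"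
    using square_W[OF assms] by auto
  show int': "integrable (P \<theta>) (\<lambda>\<omega>. (dv (W m \<omega>))\<^sup>2)"
    using le by (intro Bochner_Integration.integrable_bound[OF int] measurable_P[OF assms]) auto
  have "(\<integral>\<omega>. (dv (W m \<omega>))\<^sup>2 \<partial>P \<theta>) \<le> (\<integral>\<omega>. 2 * L\<^sup>2 * (W m \<omega>)\<^sup>2 + 2 * (dv 0)\<^sup>2 \<partial>P \<theta>)"
    using int int' le by (intro integral_mono)
  also have "\<dots> = 2 * L\<^sup>2 * (\<integral>\<omega>. (W m \<omega>)\<^sup>2 \<partial>P \<theta>) + 2 * (dv 0)\<^sup>2"
    using square_W[OF assms, of m] by (simp add: prob_space)
  also have "\<dots> \<le> 2 * L\<^sup>2 * (4 ^ m * (S / \<nu>\<^sup>2)) + 2 * (dv 0)\<^sup>2"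
    using square_W(2)[OF assms, of m] by (intro add_mono mult_left_mono) auto
  finally show "(\<integral>\<omega>. (dv (W m \<omega>))\<^sup>2 \<partial>P \<theta>) \<le> 2 * (dv 0)\<^sup>2 + 2 * L\<^sup>2 * (4 ^ m * (S / \<nu>\<^sup>2))" by simp
qed

lemma integrable_drift:
  assumes "\<theta> \<in> \<Theta>"
  shows "integrable (P \<theta>) (\<lambda>\<omega>. dv (W m \<omega>) * dev m \<omega>)"
proof (rule Bochner_Integration.integrable_bound)
  show "integrable (P \<theta>) (\<lambda>\<omega>. (dv (W m \<omega>))\<^sup>2 + (dev m \<omega>)\<^sup>2)"
    using square_dv_W[OF assms] square_dev[OF assms] by auto
  have "\<bar>x * y\<bar> \<le> \<bar>x\<^sup>2 + y\<^sup>2\<bar>" for x y :: real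
  proof -
    have "2 * \<bar>x * y\<bar> \<le> x\<^sup>2 + y\<^sup>2" using sum_squares_bound[of "\<bar>x\<bar>" "\<bar>y\<bar>"] by (simp add: abs_mult)
    moreover have "0 \<le> \<bar>x * y\<bar>" by simp
    ultimately show ?thesis by linarith
  qed
  then show "AE \<omega> in P \<theta>. norm (dv (W m \<omega>) * dev m \<omega>) \<le> norm ((dv (W m \<omega>))\<^sup>2 + (dev m \<omega>)\<^sup>2)"
    by simp
qed (intro measurable_P[OF assms]; measurable)

section \<open>Truncation errors of the observations, the means and the drift\<close>

lemma clip_error_X:
  assumes \<theta>: "\<theta> \<in> \<Theta>" and T: "0 < T"
  shows "integrable (P \<theta>) (\<lambda>\<omega>. \<bar>X (Suc m) \<omega> - clip T (X (Suc m) \<omega>)\<bar>)"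
    and "(\<integral>\<omega>. \<bar>X (Suc m) \<omega> - clip T (X (Suc m) \<omega>)\<bar> \<partial>P \<theta>) \<le> (2 * S + 2 * (\<bar>a\<bar> + \<bar>b\<bar>)\<^sup>2) / T"
proof -
  have [measurable]: "clip T \<in> borel_measurable borel" unfolding clip_def by measurable
  have int: "integrable (P \<theta>) (\<lambda>\<omega>. (X (Suc m) \<omega>)\<^sup>2 / T)" using square_X[OF \<theta>] by auto
  show int': "integrable (P \<theta>) (\<lambda>\<omega>. \<bar>X (Suc m) \<omega> - clip T (X (Suc m) \<omega>)\<bar>)"
    using clip_error[OF T] T by (intro Bochner_Integration.integrable_bound[OF int] measurable_P[OF \<theta>]) auto
  have "(\<integral>\<omega>. \<bar>X (Suc m) \<omega> - clip T (X (Suc m) \<omega>)\<bar> \<partial>P \<theta>) \<le> (\<integral>\<omega>. (X (Suc m) \<omega>)\<^sup>2 / T \<partial>P \<theta>)"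
    using int int' clip_error[OF T] by (intro integral_mono)
  also have "\<dots> \<le> (2 * S + 2 * (\<bar>a\<bar> + \<bar>b\<bar>)\<^sup>2) / T"
    using square_X(2)[OF \<theta>, of m] T by (simp add: divide_right_mono)
  finally show "(\<integral>\<omega>. \<bar>X (Suc m) \<omega> - clip T (X (Suc m) \<omega>)\<bar> \<partial>P \<theta>) \<le> (2 * S + 2 * (\<bar>a\<bar> + \<bar>b\<bar>)\<^sup>2) / T" .
qed

text \<open>The error under a single measure does not depend on \<theta>, so it passes to the
  suprema in both directions.\<close>

lemma clip_error_means:
  assumes T: "0 < T"
  shows "\<bar>a - EE (\<lambda>\<omega>. clip T (X 1 \<omega>))\<bar> \<le> (2 * S + 2 * (\<bar>a\<bar> + \<bar>b\<bar>)\<^sup>2) / T"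
    and "\<bar>b - (- EE (\<lambda>\<omega>. - clip T (X 1 \<omega>)))\<bar> \<le> (2 * S + 2 * (\<bar>a\<bar> + \<bar>b\<bar>)\<^sup>2) / T"
proof -
  let ?K = "(2 * S + 2 * (\<bar>a\<bar> + \<bar>b\<bar>)\<^sup>2) / T"
  have [measurable]: "clip T \<in> borel_measurable borel" unfolding clip_def by measurable
  have near: "\<bar>(\<integral>\<omega>. X 1 \<omega> \<partial>P \<theta>) - (\<integral>\<omega>. clip T (X 1 \<omega>) \<partial>P \<theta>)\<bar> \<le> ?K" if \<theta>: "\<theta> \<in> \<Theta>" for \<theta>
  proof -
    have c: "integrable (P \<theta>) (\<lambda>\<omega>. clip T (X 1 \<omega>))"
      using T clip_bound by (intro integrable_bounded[OF \<theta>, where B = T]) auto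
    have "integrable (P \<theta>) (\<lambda>\<omega>. X 1 \<omega> - clip T (X 1 \<omega>))"
      using clip_error_X(1)[OF \<theta> T, of 0] by (subst (asm) integrable_abs_iff) (auto intro!: measurable_P[OF \<theta>])
    then have "integrable (P \<theta>) (\<lambda>\<omega>. (X 1 \<omega> - clip T (X 1 \<omega>)) + clip T (X 1 \<omega>))"
      using c by (rule Bochner_Integration.integrable_add)
    then have "(\<integral>\<omega>. X 1 \<omega> \<partial>P \<theta>) - (\<integral>\<omega>. clip T (X 1 \<omega>) \<partial>P \<theta>) = (\<integral>\<omega>. X 1 \<omega> - clip T (X 1 \<omega>) \<partial>P \<theta>)"
      using c by simp
    then have "\<bar>(\<integral>\<omega>. X 1 \<omega> \<partial>P \<theta>) - (\<integral>\<omega>. clip T (X 1 \<omega>) \<partial>P \<theta>)\<bar> \<le> (\<integral>\<omega>. \<bar>X 1 \<omega> - clip T (X 1 \<omega>)\<bar> \<partial>P \<theta>)"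
      by (simp only: integral_abs_bound)
    also have "\<dots> \<le> ?K" using clip_error_X(2)[OF \<theta> T, of 0] by simp
    finally show ?thesis .
  qed
  have clip_le: "(\<integral>\<omega>. clip T (X 1 \<omega>) \<partial>P \<theta>) \<le> EE (\<lambda>\<omega>. clip T (X 1 \<omega>))"
    "(\<integral>\<omega>. - clip T (X 1 \<omega>) \<partial>P \<theta>) \<le> EE (\<lambda>\<omega>. - clip T (X 1 \<omega>))" if "\<theta> \<in> \<Theta>" for \<theta>
    using that T clip_bound by (intro integral_le_EE[where B = T]; simp)+
  have "EE (X 1) \<le> EE (\<lambda>\<omega>. clip T (X 1 \<omega>)) + ?K"
  proof (rule EE_le)
    fix \<theta> assume \<theta>: "\<theta> \<in> \<Theta>"
    show "(\<integral>\<omega>. X 1 \<omega> \<partial>P \<theta>) \<le> EE (\<lambda>\<omega>. clip T (X 1 \<omega>)) + ?K"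
      using near[OF \<theta>] clip_le(1)[OF \<theta>] by linarith
  qed
  moreover have "EE (\<lambda>\<omega>. clip T (X 1 \<omega>)) \<le> a + ?K"
  proof (rule EE_le)
    fix \<theta> assume \<theta>: "\<theta> \<in> \<Theta>"
    show "(\<integral>\<omega>. clip T (X 1 \<omega>) \<partial>P \<theta>) \<le> a + ?K"
      using near[OF \<theta>] integral_X1_bounds[OF \<theta>] by linarith
  qed
  ultimately show "\<bar>a - EE (\<lambda>\<omega>. clip T (X 1 \<omega>))\<bar> \<le> ?K"
    unfolding a_def[symmetric] by linarith
  have "EE (\<lambda>\<omega>. - X 1 \<omega>) \<le> EE (\<lambda>\<omega>. - clip T (X 1 \<omega>)) + ?K"
  proof (rule EE_le)
    fix \<theta> assume \<theta>: "\<theta> \<in> \<Theta>"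
    show "(\<integral>\<omega>. - X 1 \<omega> \<partial>P \<theta>) \<le> EE (\<lambda>\<omega>. - clip T (X 1 \<omega>)) + ?K"
      using near[OF \<theta>] clip_le(2)[OF \<theta>] unfolding integral_minus by linarith
  qed
  moreover have "EE (\<lambda>\<omega>. - clip T (X 1 \<omega>)) \<le> - b + ?K"
  proof (rule EE_le)
    fix \<theta> assume \<theta>: "\<theta> \<in> \<Theta>"
    show "(\<integral>\<omega>. - clip T (X 1 \<omega>) \<partial>P \<theta>) \<le> - b + ?K"
      using near[OF \<theta>] integral_X1_bounds[OF \<theta>] unfolding integral_minus by linarith
  qed
  moreover have "EE (\<lambda>\<omega>. - X 1 \<omega>) = - b" using b_def by linarith
  ultimately show "\<bar>b - (- EE (\<lambda>\<omega>. - clip T (X 1 \<omega>)))\<bar> \<le> ?K" by linarith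
qed

text \<open>One part of the error comes from truncating \<open>dv\<close> and multiplies
  \<open>dev m\<close>. The squares of \<open>dv (W m)\<close> are bounded in mean but need not be
  uniformly integrable, so Cauchy-Schwarz would not make it small. Instead \<open>\<bar>dev m
  \<omega>\<bar> \<le> 1 + (dev m \<omega>)\<^sup>2\<close> is used with
  \<open>integral_square_dev_le\<close>, where the truncation error is the weight; hence the factor
  \<open>1 + S\<close>. The other part, from truncating the observation and its mean, multiplies a
  factor bounded by \<open>R\<close>.\<close>

lemma drift_gain_close:
  assumes R: "0 < R" and T: "0 < T" and \<theta>: "\<theta> \<in> \<Theta>"
  shows "\<bar>(\<integral>\<omega>. dv (W m \<omega>) * dev m \<omega> \<partial>P \<theta>) - (\<integral>\<omega>. gain (\<lambda>w. clip R (dv w)) (clip T) (W m \<omega>) (X (Suc m) \<omega>) \<partial>P \<theta>)\<bar>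
    \<le> (1 + S) * (2 * (dv 0)\<^sup>2 + 2 * L\<^sup>2 * (4 ^ m * (S / \<nu>\<^sup>2))) / R + R * (2 * ((2 * S + 2 * (\<bar>a\<bar> + \<bar>b\<bar>)\<^sup>2) / T))"
proof -
  interpret prob_space "P \<theta>" using \<theta> by (rule prob_space_P)
  let ?K = "(2 * S + 2 * (\<bar>a\<bar> + \<bar>b\<bar>)\<^sup>2) / T"
  let ?D = "2 * (dv 0)\<^sup>2 + 2 * L\<^sup>2 * (4 ^ m * (S / \<nu>\<^sup>2))"
  let ?d = "\<lambda>w. clip R (dv w)"
  let ?g = "\<lambda>\<omega>. gain ?d (clip T) (W m \<omega>) (X (Suc m) \<omega>)"
  define p where "p = EE (\<lambda>\<omega>. clip T (X 1 \<omega>))"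
  define q where "q = - EE (\<lambda>\<omega>. - clip T (X 1 \<omega>))"
  let ?\<psi> = "\<lambda>w. \<bar>dv w - ?d w\<bar>"
  let ?e = "\<lambda>\<omega>. \<bar>X (Suc m) \<omega> - clip T (X (Suc m) \<omega>)\<bar>"
  have d: "continuous_on UNIV ?d" "\<And>w. \<bar>?d w\<bar> \<le> R" and t: "continuous_on UNIV (clip T)" "\<And>y. \<bar>clip T y\<bar> \<le> T"
    using continuous_clip[OF continuous_dv] continuous_clip[OF continuous_on_id, of T] clip_bound R T by auto
  have [measurable]: "clip R \<in> borel_measurable borel" unfolding clip_def by measurable
  have \<psi>c: "continuous_on UNIV ?\<psi>" using d(1) continuous_dv by (intro continuous_intros)
  have sq: "integrable (P \<theta>) (\<lambda>\<omega>. (dv (W m \<omega>))\<^sup>2 / R)" using square_dv_W(1)[OF \<theta>] by auto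
  have \<psi>int: "integrable (P \<theta>) (\<lambda>\<omega>. ?\<psi> (W m \<omega>))"
    using clip_error[OF R] R by (intro Bochner_Integration.integrable_bound[OF sq] measurable_P[OF \<theta>]) auto
  have "(\<integral>\<omega>. ?\<psi> (W m \<omega>) \<partial>P \<theta>) \<le> (\<integral>\<omega>. (dv (W m \<omega>))\<^sup>2 / R \<partial>P \<theta>)"
    using \<psi>int sq clip_error[OF R] by (intro integral_mono)
  also have "\<dots> \<le> ?D / R" using square_dv_W(2)[OF \<theta>, of m] R by (simp add: divide_right_mono)
  finally have \<psi>le: "(\<integral>\<omega>. ?\<psi> (W m \<omega>) \<partial>P \<theta>) \<le> ?D / R" .
  note \<psi>dev = integral_square_dev_le[OF \<theta> \<psi>c abs_ge_zero \<psi>int]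
  note e = clip_error_X[OF \<theta> T, of m]
  have pw: "\<bar>dv (W m \<omega>) * dev m \<omega> - ?g \<omega>\<bar> \<le>
      (?\<psi> (W m \<omega>) + ?\<psi> (W m \<omega>) * (dev m \<omega>)\<^sup>2) + R * (?e \<omega> + ?K)" for \<omega>
  proof -
    define w where "w = W m \<omega>"
    define y where "y = X (Suc m) \<omega>"
    define s where "s = (if dv w \<ge> 0 then p else q)"
    \<comment> \<open>Clipping at a positive level preserves the sign, so the gain switches its mean
      where the centering switches.\<close>
    have g: "?g \<omega> = ?d w * (clip T y - s)"
      using R unfolding gain_def w_def[symmetric] y_def[symmetric] p_def[symmetric] q_def[symmetric]
      by (auto simp: s_def clip_def max_def min_def algebra_simps)
    have "\<bar>target w - s\<bar> \<le> ?K"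
      using clip_error_means[OF T] by (simp add: target_def s_def p_def q_def)
    then have "\<bar>(y - clip T y) - (target w - s)\<bar> \<le> \<bar>y - clip T y\<bar> + ?K" by linarith
    then have 1: "\<bar>?d w * ((y - clip T y) - (target w - s))\<bar> \<le> R * (\<bar>y - clip T y\<bar> + ?K)"
      unfolding abs_mult using d(2)[of w] R by (intro mult_mono) auto
    have "\<bar>dev m \<omega>\<bar> \<le> 1 + (dev m \<omega>)\<^sup>2"
      using sum_squares_bound[of 1 "\<bar>dev m \<omega>\<bar>"] by simp
    then have "?\<psi> w * \<bar>dev m \<omega>\<bar> \<le> ?\<psi> w * (1 + (dev m \<omega>)\<^sup>2)" by (intro mult_left_mono) auto
    then have 2: "\<bar>(dv w - ?d w) * dev m \<omega>\<bar> \<le> ?\<psi> w + ?\<psi> w * (dev m \<omega>)\<^sup>2"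
      by (simp add: abs_mult distrib_left)
    have "dv w * dev m \<omega> - ?g \<omega> = (dv w - ?d w) * dev m \<omega> + ?d w * ((y - clip T y) - (target w - s))"
      unfolding g by (simp add: dev_def w_def y_def algebra_simps)
    then show ?thesis using 1 2 unfolding w_def y_def by linarith
  qed
  have gint: "integrable (P \<theta>) ?g" using integrable_gain[OF d t \<theta>] .
  note dint = integrable_drift[OF \<theta>, of m]
  have "\<bar>(\<integral>\<omega>. dv (W m \<omega>) * dev m \<omega> \<partial>P \<theta>) - (\<integral>\<omega>. ?g \<omega> \<partial>P \<theta>)\<bar> = \<bar>\<integral>\<omega>. dv (W m \<omega>) * dev m \<omega> - ?g \<omega> \<partial>P \<theta>\<bar>"
    using gint dint by simp
  also have "\<dots> \<le> (\<integral>\<omega>. \<bar>dv (W m \<omega>) * dev m \<omega> - ?g \<omega>\<bar> \<partial>P \<theta>)" by (rule integral_abs_bound)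
  also have "\<dots> \<le> (\<integral>\<omega>. (?\<psi> (W m \<omega>) + ?\<psi> (W m \<omega>) * (dev m \<omega>)\<^sup>2) + R * (?e \<omega> + ?K) \<partial>P \<theta>)"
    using pw gint dint \<psi>int \<psi>dev(1) e(1) by (intro integral_mono) auto
  also have "\<dots> = ((\<integral>\<omega>. ?\<psi> (W m \<omega>) \<partial>P \<theta>) + (\<integral>\<omega>. ?\<psi> (W m \<omega>) * (dev m \<omega>)\<^sup>2 \<partial>P \<theta>)) + R * ((\<integral>\<omega>. ?e \<omega> \<partial>P \<theta>) + ?K)"
    using \<psi>int \<psi>dev(1) e(1) by (simp add: prob_space)
  also have "\<dots> \<le> ((\<integral>\<omega>. ?\<psi> (W m \<omega>) \<partial>P \<theta>) + S * (\<integral>\<omega>. ?\<psi> (W m \<omega>) \<partial>P \<theta>)) + R * (?K + ?K)"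
    using \<psi>dev(2) e(2) R by (intro add_mono mult_left_mono) auto
  also have "\<dots> = (1 + S) * (\<integral>\<omega>. ?\<psi> (W m \<omega>) \<partial>P \<theta>) + R * (2 * ?K)" by (simp add: algebra_simps)
  also have "\<dots> \<le> (1 + S) * (?D / R) + R * (2 * ?K)"
    using \<psi>le S_nonneg by (intro add_right_mono mult_left_mono) auto
  finally show ?thesis by simp
qed

lemma gain_approximates_drift:
  assumes \<delta>: "0 < \<delta>"
  shows "\<exists>R>0. \<exists>T>0. \<forall>\<theta>\<in>\<Theta>. \<forall>k\<le>N.
      \<bar>(\<integral>\<omega>. dv (W k \<omega>) * dev k \<omega> \<partial>P \<theta>) -
        (\<integral>\<omega>. gain (\<lambda>w. clip R (dv w)) (clip T) (W k \<omega>) (X (Suc k) \<omega>) \<partial>P \<theta>)\<bar> \<le> \<delta>"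
proof -
  define D where "D m = (1 + S) * (2 * (dv 0)\<^sup>2 + 2 * L\<^sup>2 * (4 ^ m * (S / \<nu>\<^sup>2)))" for m :: nat
  define K where "K = 2 * (2 * S + 2 * (\<bar>a\<bar> + \<bar>b\<bar>)\<^sup>2)"
  have c0: "0 \<le> 2 * L\<^sup>2 * (S / \<nu>\<^sup>2)" using S_nonneg by simp
  have D0: "0 \<le> D m" for m
    unfolding D_def using S_nonneg by simp
  have Dmono: "D m \<le> D N" if "m \<le> N" for m
  proof -
    have "(4 :: real) ^ m \<le> 4 ^ N" using that by (intro power_increasing) auto
    then have "4 ^ m * (2 * L\<^sup>2 * (S / \<nu>\<^sup>2)) \<le> 4 ^ N * (2 * L\<^sup>2 * (S / \<nu>\<^sup>2))"
      using c0 by (rule mult_right_mono)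
    then have "2 * L\<^sup>2 * (4 ^ m * (S / \<nu>\<^sup>2)) \<le> 2 * L\<^sup>2 * (4 ^ N * (S / \<nu>\<^sup>2))"
      by (simp only: mult.left_commute)
    then show ?thesis
      unfolding D_def using S_nonneg by (intro mult_left_mono[OF add_left_mono]) auto
  qed
  have K0: "0 \<le> K" using S_nonneg by (simp add: K_def)
  \<comment> \<open>The second error contains \<open>R / T\<close>, so \<open>R\<close> is fixed
    first and \<open>T\<close> is taken large against it. Each error is then at most half of
    \<open>\<delta>\<close>; the summand 1 keeps the levels positive.\<close>
  define R where "R = 2 * D N / \<delta> + 1"
  define T where "T = 2 * (R * K) / \<delta> + 1"
  have R: "0 < R" using D0[of N] \<delta> by (simp add: R_def add_nonneg_pos)
  have T: "0 < T" using K0 R \<delta> by (simp add: T_def add_nonneg_pos)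
  have "D N / R \<le> \<delta> / 2" using R \<delta> D0[of N] unfolding R_def by (simp add: field_simps)
  moreover have "(R * K) / T \<le> \<delta> / 2" using T \<delta> unfolding T_def by (simp add: field_simps)
  ultimately have small: "D N / R + (R * K) / T \<le> \<delta>" by linarith
  show ?thesis
  proof (rule exI[of _ R], rule conjI[OF R], rule exI[of _ T], rule conjI[OF T], intro ballI allI impI)
    fix \<theta> m assume \<theta>: "\<theta> \<in> \<Theta>" and m: "m \<le> N"
    have "\<bar>(\<integral>\<omega>. dv (W m \<omega>) * dev m \<omega> \<partial>P \<theta>) - (\<integral>\<omega>. gain (\<lambda>w. clip R (dv w)) (clip T) (W m \<omega>) (X (Suc m) \<omega>) \<partial>P \<theta>)\<bar>
        \<le> D m / R + (R * K) / T"
      using drift_gain_close[OF R T \<theta>, of m] by (simp add: D_def K_def)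
    also have "\<dots> \<le> D N / R + (R * K) / T" using Dmono[OF m] R by (simp add: divide_right_mono)
    finally show "\<bar>(\<integral>\<omega>. dv (W m \<omega>) * dev m \<omega> \<partial>P \<theta>) -
        (\<integral>\<omega>. gain (\<lambda>w. clip R (dv w)) (clip T) (W m \<omega>) (X (Suc m) \<omega>) \<partial>P \<theta>)\<bar> \<le> \<delta>"
      using small by linarith
  qed
qed

lemma clip_admissible:
  assumes "0 < R" "0 < T"
  shows "continuous_on UNIV (\<lambda>w. clip R (dv w))" "\<And>w. \<bar>clip R (dv w)\<bar> \<le> R"
    and "continuous_on UNIV (clip T)" "\<And>y. \<bar>clip T y\<bar> \<le> T"
  using continuous_clip[OF continuous_dv] continuous_clip[OF continuous_on_id, of T] clip_bound assms by auto

lemma integral_drift_le: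
  assumes \<theta>: "\<theta> \<in> \<Theta>"
  shows "(\<integral>\<omega>. dv (W m \<omega>) * dev m \<omega> \<partial>P \<theta>) \<le> 0"
proof (rule field_le_epsilon)
  fix \<delta> :: real assume \<delta>: "0 < \<delta>"
  obtain R T where RT: "0 < R" "0 < T" and close: "\<forall>\<theta>\<in>\<Theta>. \<forall>k\<le>m.
      \<bar>(\<integral>\<omega>. dv (W k \<omega>) * dev k \<omega> \<partial>P \<theta>) -
        (\<integral>\<omega>. gain (\<lambda>w. clip R (dv w)) (clip T) (W k \<omega>) (X (Suc k) \<omega>) \<partial>P \<theta>)\<bar> \<le> \<delta>"
    using gain_approximates_drift[OF \<delta>, of m] by blast
  show "(\<integral>\<omega>. dv (W m \<omega>) * dev m \<omega> \<partial>P \<theta>) \<le> 0 + \<delta>"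
    using close[rule_format, OF \<theta> order_refl] integral_gain_le[OF clip_admissible[OF RT] \<theta>, of m] by linarith
qed

lemma near_optimal_drift:
  assumes \<epsilon>: "0 < \<epsilon>"
  obtains \<theta> where "\<theta> \<in> \<Theta>" "\<And>m. m < N \<Longrightarrow> - \<epsilon> \<le> (\<integral>\<omega>. dv (W m \<omega>) * dev m \<omega> \<partial>P \<theta>)"
proof -
  have "0 < \<epsilon> / 2" using \<epsilon> by simp
  then obtain R T where RT: "0 < R" "0 < T" and close: "\<forall>\<theta>\<in>\<Theta>. \<forall>k\<le>N.
      \<bar>(\<integral>\<omega>. dv (W k \<omega>) * dev k \<omega> \<partial>P \<theta>) -
        (\<integral>\<omega>. gain (\<lambda>w. clip R (dv w)) (clip T) (W k \<omega>) (X (Suc k) \<omega>) \<partial>P \<theta>)\<bar> \<le> \<epsilon> / 2"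
    using gain_approximates_drift[of "\<epsilon> / 2" N] by blast
  \<comment> \<open>\<open>near_optimal_gain\<close> loses a factor \<open>N\<close>; the
    denominator \<open>real N + 1\<close> also covers \<open>N = 0\<close>.\<close>
  have "0 < \<epsilon> / 2 / (real N + 1)" using \<epsilon> by simp
  then obtain \<theta> where \<theta>: "\<theta> \<in> \<Theta>" and g: "\<forall>m<N. - (\<epsilon> / 2 / (real N + 1) * real N) \<le>
      (\<integral>\<omega>. gain (\<lambda>w. clip R (dv w)) (clip T) (W m \<omega>) (X (Suc m) \<omega>) \<partial>P \<theta>)"
    using near_optimal_gain[OF clip_admissible[OF RT]] by blast
  have "\<epsilon> / 2 / (real N + 1) * real N \<le> \<epsilon> / 2" using \<epsilon> by (simp add: field_simps)
  then have "- \<epsilon> \<le> (\<integral>\<omega>. dv (W m \<omega>) * dev m \<omega> \<partial>P \<theta>)" if "m < N" for m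
    using close[rule_format, OF \<theta>, of m] g[rule_format, OF that] that by linarith
  then show thesis using that \<theta> by blast
qed

section \<open>Expansion of the test function along the path\<close>

text \<open>The increments of \<open>W\<close> are \<open>dev j / \<nu>\<close>, so \<open>S\<close>
  bounds every quadratic remainder in mean. Integrability of \<open>\<phi> (W m)\<close> comes from
  the same induction: each step adds an integrable drift and an integrable remainder.\<close>

lemma integral_expansion:
  assumes diff: "\<And>x. \<phi> differentiable (at x)" and dv: "deriv \<phi> = dv" and \<theta>: "\<theta> \<in> \<Theta>"
  shows "integrable (P \<theta>) (\<lambda>\<omega>. \<phi> (W m \<omega>))"
    and "\<bar>(\<integral>\<omega>. \<phi> (W m \<omega>) \<partial>P \<theta>) - \<phi> 0 - (\<Sum>j<m. (\<integral>\<omega>. dv (W j \<omega>) * dev j \<omega> \<partial>P \<theta>) / \<nu>)\<bar>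
      \<le> real m * (L / 2 * (S / \<nu>\<^sup>2))"
proof -
  interpret prob_space "P \<theta>" using \<theta> by (rule prob_space_P)
  have taylor: "\<bar>\<phi> y - \<phi> x - dv x * (y - x)\<bar> \<le> L / 2 * (y - x)\<^sup>2" for x y
    using taylor_bound_lipschitz_deriv[OF diff, of L y x] lipschitz_dv by (simp add: dv)
  have L0: "0 \<le> L" using lipschitz_dv by (rule lipschitz_on_nonneg)
  let ?r = "\<lambda>j \<omega>. L / 2 * ((dev j \<omega>)\<^sup>2 / \<nu>\<^sup>2)"
  let ?t = "\<lambda>j \<omega>. \<phi> (W (Suc j) \<omega>) - \<phi> (W j \<omega>) - dv (W j \<omega>) * dev j \<omega> / \<nu>"
  have "continuous_on UNIV \<phi>"
    using diff by (auto intro!: differentiable_imp_continuous_on simp: differentiable_on_def differentiable_at_withinI)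
  then have [measurable]: "\<phi> \<in> borel_measurable borel" by (rule borel_measurable_continuous_onI)
  have pw: "\<bar>?t j \<omega>\<bar> \<le> ?r j \<omega>" for j \<omega>
    using taylor[of "W (Suc j) \<omega>" "W j \<omega>"] by (simp add: W_Suc power_divide)
  have rint: "integrable (P \<theta>) (?r j)" for j using square_dev[OF \<theta>] by auto
  have tint: "integrable (P \<theta>) (?t j)" for j
    using pw L0 by (intro Bochner_Integration.integrable_bound[OF rint[of j]] measurable_P[OF \<theta>]) (auto simp: abs_mult)
  have dint: "integrable (P \<theta>) (\<lambda>\<omega>. dv (W j \<omega>) * dev j \<omega> / \<nu>)" for j
    using integrable_drift[OF \<theta>] by auto
  have tle: "\<bar>\<integral>\<omega>. ?t j \<omega> \<partial>P \<theta>\<bar> \<le> L / 2 * (S / \<nu>\<^sup>2)" for j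
  proof -
    have "\<bar>\<integral>\<omega>. ?t j \<omega> \<partial>P \<theta>\<bar> \<le> (\<integral>\<omega>. \<bar>?t j \<omega>\<bar> \<partial>P \<theta>)" by (rule integral_abs_bound)
    also have "\<dots> \<le> (\<integral>\<omega>. ?r j \<omega> \<partial>P \<theta>)"
      using pw by (intro integral_mono integrable_abs tint rint)
    also have "\<dots> = L / 2 * ((\<integral>\<omega>. (dev j \<omega>)\<^sup>2 \<partial>P \<theta>) / \<nu>\<^sup>2)" by simp
    also have "\<dots> \<le> L / 2 * (S / \<nu>\<^sup>2)"
      using square_dev(2)[OF \<theta>, of j] L0 by (intro mult_left_mono divide_right_mono) auto
    finally show ?thesis .
  qed
  have "integrable (P \<theta>) (\<lambda>\<omega>. \<phi> (W m \<omega>)) \<and>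
    \<bar>(\<integral>\<omega>. \<phi> (W m \<omega>) \<partial>P \<theta>) - \<phi> 0 - (\<Sum>j<m. (\<integral>\<omega>. dv (W j \<omega>) * dev j \<omega> \<partial>P \<theta>) / \<nu>)\<bar>
      \<le> real m * (L / 2 * (S / \<nu>\<^sup>2))"
  proof (induction m)
    case 0
    then show ?case by (simp add: W_0 prob_space)
  next
    case (Suc m)
    have eq: "\<phi> (W (Suc m) \<omega>) = \<phi> (W m \<omega>) + dv (W m \<omega>) * dev m \<omega> / \<nu> + ?t m \<omega>" for \<omega> by simp
    have int: "integrable (P \<theta>) (\<lambda>\<omega>. \<phi> (W (Suc m) \<omega>))"
    proof -
      have "integrable (P \<theta>) (\<lambda>\<omega>. \<phi> (W m \<omega>) + dv (W m \<omega>) * dev m \<omega> / \<nu> + ?t m \<omega>)"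
        using Suc dint tint by (intro Bochner_Integration.integrable_add) blast+
      then show ?thesis by (simp only: eq[symmetric])
    qed
    have "(\<integral>\<omega>. ?t m \<omega> \<partial>P \<theta>) = (\<integral>\<omega>. \<phi> (W (Suc m) \<omega>) \<partial>P \<theta>) - (\<integral>\<omega>. \<phi> (W m \<omega>) \<partial>P \<theta>) -
        (\<integral>\<omega>. dv (W m \<omega>) * dev m \<omega> \<partial>P \<theta>) / \<nu>"
      using int Suc dint[of m] by simp
    then have "\<bar>(\<integral>\<omega>. \<phi> (W (Suc m) \<omega>) \<partial>P \<theta>) - (\<integral>\<omega>. \<phi> (W m \<omega>) \<partial>P \<theta>) -
        (\<integral>\<omega>. dv (W m \<omega>) * dev m \<omega> \<partial>P \<theta>) / \<nu>\<bar> \<le> L / 2 * (S / \<nu>\<^sup>2)"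
      using tle[of m] by (simp only:)
    moreover have "real (Suc m) * (L / 2 * (S / \<nu>\<^sup>2)) = real m * (L / 2 * (S / \<nu>\<^sup>2)) + L / 2 * (S / \<nu>\<^sup>2)"
      unfolding of_nat_Suc by algebra
    ultimately show ?case using int Suc unfolding sum.lessThan_Suc by linarith
  qed
  then show "integrable (P \<theta>) (\<lambda>\<omega>. \<phi> (W m \<omega>))"
    and "\<bar>(\<integral>\<omega>. \<phi> (W m \<omega>) \<partial>P \<theta>) - \<phi> 0 - (\<Sum>j<m. (\<integral>\<omega>. dv (W j \<omega>) * dev j \<omega> \<partial>P \<theta>) / \<nu>)\<bar>
      \<le> real m * (L / 2 * (S / \<nu>\<^sup>2))" by auto
qed

lemma EE_expansion:
  assumes diff: "\<And>x. \<phi> differentiable (at x)" and dv: "deriv \<phi> = dv" and \<nu>: "0 < \<nu>"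
  shows "\<bar>EE (\<lambda>\<omega>. \<phi> (W m \<omega>)) - \<phi> 0\<bar> \<le> real m * (L / 2 * (S / \<nu>\<^sup>2))"
proof -
  let ?B = "real m * (L / 2 * (S / \<nu>\<^sup>2))"
  have up: "(\<integral>\<omega>. \<phi> (W m \<omega>) \<partial>P \<theta>) \<le> \<phi> 0 + ?B" if "\<theta> \<in> \<Theta>" for \<theta>
  proof -
    have "(\<Sum>j<m. (\<integral>\<omega>. dv (W j \<omega>) * dev j \<omega> \<partial>P \<theta>) / \<nu>) \<le> 0"
      using integral_drift_le[OF that] \<nu> by (intro sum_nonpos) (simp add: divide_le_0_iff)
    then show ?thesis using integral_expansion(2)[OF diff dv that, of m] by linarith
  qed
  then have "EE (\<lambda>\<omega>. \<phi> (W m \<omega>)) \<le> \<phi> 0 + ?B" by (rule EE_le)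
  moreover have "\<phi> 0 - ?B \<le> EE (\<lambda>\<omega>. \<phi> (W m \<omega>))"
  proof (rule field_le_epsilon)
    fix \<epsilon> :: real assume \<epsilon>: "0 < \<epsilon>"
    \<comment> \<open>The \<open>m\<close> drift terms, divided by \<open>\<nu>\<close>, then lose
      at most \<open>\<epsilon>\<close> in total, also for \<open>m = 0\<close>.\<close>
    define \<delta> where "\<delta> = \<epsilon> * \<nu> / (real m + 1)"
    have "0 < \<delta>" using \<epsilon> \<nu> by (simp add: \<delta>_def)
    then obtain \<theta> where \<theta>: "\<theta> \<in> \<Theta>" and low: "\<And>j. j < m \<Longrightarrow> - \<delta> \<le> (\<integral>\<omega>. dv (W j \<omega>) * dev j \<omega> \<partial>P \<theta>)"
      using near_optimal_drift[of \<delta> m] by blast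
    have "(\<Sum>j<m. (- \<delta>) / \<nu>) \<le> (\<Sum>j<m. (\<integral>\<omega>. dv (W j \<omega>) * dev j \<omega> \<partial>P \<theta>) / \<nu>)"
      using low \<nu> by (intro sum_mono divide_right_mono) auto
    moreover have "- \<epsilon> \<le> (\<Sum>j<m. (- \<delta>) / \<nu>)"
    proof -
      have "\<delta> / \<nu> = \<epsilon> / (real m + 1)" using \<nu> by (simp add: \<delta>_def)
      moreover have "real m * (\<epsilon> / (real m + 1)) \<le> \<epsilon>" using \<epsilon> by (simp add: field_simps)
      ultimately show ?thesis by simp
    qed
    ultimately have "\<phi> 0 - ?B - \<epsilon> \<le> (\<integral>\<omega>. \<phi> (W m \<omega>) \<partial>P \<theta>)"
      using integral_expansion(2)[OF diff dv \<theta>, of m] by linarith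
    \<comment> \<open>A supremum of reals dominates its members only if they are bounded above; the
      upper estimate \<open>up\<close> supplies this.\<close>
    also have "\<dots> \<le> EE (\<lambda>\<omega>. \<phi> (W m \<omega>))"
      unfolding sublinear_expectation_def using up by (intro cSUP_upper[OF \<theta>] bdd_aboveI2)
    finally show "\<phi> 0 - ?B \<le> EE (\<lambda>\<omega>. \<phi> (W m \<omega>)) + \<epsilon>" by simp
  qed
  ultimately show ?thesis by linarith
qed

end

theorem theorem2p3:
  fixes M :: "'a measure"
    and P :: "'t \<Rightarrow> 'a measure"
    and \<Theta> :: "'t set"
    and X :: "nat \<Rightarrow> 'a \<Rightarrow> real"
    and \<phi> :: "real \<Rightarrow> real"
    and n :: nat
    and \<mu>_upper \<mu>_lower \<sigma>2_upper C\<^sub>0 :: real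
    and \<mu> :: "nat \<Rightarrow> 'a \<Rightarrow> real"
  assumes "\<Theta> \<noteq> {}"
    and "\<And>\<theta>. \<theta> \<in> \<Theta> \<Longrightarrow> prob_space (P \<theta>)"
    and "\<And>\<theta>. \<theta> \<in> \<Theta> \<Longrightarrow> sets (P \<theta>) = sets M"
    and "\<And>i. i \<ge> 1 \<Longrightarrow> X i \<in> borel_measurable M"
    and "iid_sequence P \<Theta> X"
    and "(SUP \<theta>\<in>\<Theta>. \<integral>\<^sup>+\<omega>. ennreal ((X 1 \<omega>)\<^sup>2) \<partial>P \<theta>) < \<infinity>"
    and "\<mu>_upper = sublinear_expectation P \<Theta> (X 1)"
    and "\<mu>_lower = - sublinear_expectation P \<Theta> (\<lambda>\<omega>. - X 1 \<omega>)"
    and "\<sigma>2_upper = (SUP \<theta>\<in>\<Theta>. \<integral>\<omega>. (X 1 \<omega> - (\<integral>\<omega>'. X 1 \<omega>' \<partial>P \<theta>))\<^sup>2 \<partial>P \<theta>)"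
    and "C\<^sub>0 = 1 / 2 * (\<sigma>2_upper + (\<mu>_upper - \<mu>_lower)\<^sup>2)"
    and "\<And>x. \<phi> differentiable (at x)"
    and "\<exists>L. L-lipschitz_on UNIV (deriv \<phi>)"
    and "n \<ge> 1"
    and "\<And>i \<omega>. \<mu> i \<omega> = centering (deriv \<phi>) \<mu>_upper \<mu>_lower n (\<lambda>j. X j \<omega>) i"
  shows "\<bar>sublinear_expectation P \<Theta> (\<lambda>\<omega>. \<phi> ((\<Sum>i=1..n. X i \<omega> - \<mu> i \<omega>) / real n)) - \<phi> 0\<bar>
    \<le> C\<^sub>0 * lipschitz_constant (deriv \<phi>) / real n"
proof -
  interpret iid_sequence_space M P \<Theta> X
    using assms(1-5) by (rule iid_sequence_space.intro)
  \<comment> \<open>The extended integral makes the moment hypothesis meaningful before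
    integrability is known; its finiteness yields both integrability and a bound common to all
    \<theta>.\<close>
  define c where "c = (SUP \<theta>\<in>\<Theta>. \<integral>\<^sup>+\<omega>. ennreal ((X 1 \<omega>)\<^sup>2) \<partial>P \<theta>)"
  have c: "c \<noteq> \<infinity>" using assms(6) unfolding c_def[symmetric] by auto
  have X1 [measurable]: "X 1 \<in> borel_measurable M" by (rule measurable_X) simp
  have nn: "(\<integral>\<^sup>+\<omega>. ennreal ((X 1 \<omega>)\<^sup>2) \<partial>P \<theta>) \<le> c" if "\<theta> \<in> \<Theta>" for \<theta>
    unfolding c_def using that by (rule SUP_upper)
  have sq: "integrable (P \<theta>) (\<lambda>\<omega>. (X 1 \<omega>)\<^sup>2)" if "\<theta> \<in> \<Theta>" for \<theta>
    using nn[OF that] c by (intro integrableI_nonneg measurable_P[OF that]) (auto simp: less_top[symmetric] top_unique)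
  have sq_le: "(\<integral>\<omega>. (X 1 \<omega>)\<^sup>2 \<partial>P \<theta>) \<le> enn2real c" if "\<theta> \<in> \<Theta>" for \<theta>
  proof -
    have "ennreal (\<integral>\<omega>. (X 1 \<omega>)\<^sup>2 \<partial>P \<theta>) \<le> c"
      using nn[OF that] sq[OF that] by (subst nn_integral_eq_integral[symmetric]) auto
    then have "enn2real (ennreal (\<integral>\<omega>. (X 1 \<omega>)\<^sup>2 \<partial>P \<theta>)) \<le> enn2real c"
      using c by (intro enn2real_mono) (auto simp: less_top[symmetric])
    then show ?thesis by simp
  qed
  have int: "integrable (P \<theta>) (X 1)" if "\<theta> \<in> \<Theta>" for \<theta>
  proof -
    interpret prob_space "P \<theta>" using that by (rule prob_space_P)
    show ?thesis using sq[OF that] measurable_P[OF that X1] by (rule square_integrable_imp_integrable[rotated])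
  qed
  have mean_bound: "\<bar>\<integral>\<omega>. X 1 \<omega> \<partial>P \<theta>\<bar> \<le> 1 + enn2real c" if \<theta>: "\<theta> \<in> \<Theta>" for \<theta>
  proof -
    interpret prob_space "P \<theta>" using \<theta> by (rule prob_space_P)
    have "\<bar>\<integral>\<omega>. X 1 \<omega> \<partial>P \<theta>\<bar> \<le> (\<integral>\<omega>. \<bar>X 1 \<omega>\<bar> \<partial>P \<theta>)" by (rule integral_abs_bound)
    also have "\<dots> \<le> (\<integral>\<omega>. 1 + (X 1 \<omega>)\<^sup>2 \<partial>P \<theta>)"
    proof (rule integral_mono)
      show "\<bar>X 1 \<omega>\<bar> \<le> 1 + (X 1 \<omega>)\<^sup>2" for \<omega> using sum_squares_bound[of 1 "\<bar>X 1 \<omega>\<bar>"] by simp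
    qed (use int[OF \<theta>] sq[OF \<theta>] in auto)
    also have "\<dots> \<le> 1 + enn2real c" using sq[OF \<theta>] sq_le[OF \<theta>] by (simp add: prob_space)
    finally show ?thesis .
  qed
  have mean: "\<mu>_lower \<le> (\<integral>\<omega>. X 1 \<omega> \<partial>P \<theta>)" "(\<integral>\<omega>. X 1 \<omega> \<partial>P \<theta>) \<le> \<mu>_upper" if \<theta>: "\<theta> \<in> \<Theta>" for \<theta>
  proof -
    have "(\<integral>\<omega>. s * X 1 \<omega> \<partial>P \<theta>) \<le> EE (\<lambda>\<omega>. s * X 1 \<omega>)" if "s \<in> {1, -1}" for s
      unfolding sublinear_expectation_def using mean_bound that
      by (intro cSUP_upper[OF \<theta>] bdd_aboveI2[where M = "1 + enn2real c"]) (force simp: abs_le_iff)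
    from this[of 1] this[of "-1"] show "\<mu>_lower \<le> (\<integral>\<omega>. X 1 \<omega> \<partial>P \<theta>)" "(\<integral>\<omega>. X 1 \<omega> \<partial>P \<theta>) \<le> \<mu>_upper"
      by (simp_all add: assms(7,8))
  qed
  define S where "S = \<sigma>2_upper + (\<mu>_upper - \<mu>_lower)\<^sup>2"
  have dev_sq: "integrable (P \<theta>) (\<lambda>\<omega>. (X 1 \<omega> - s)\<^sup>2) \<and>
      (\<integral>\<omega>. (X 1 \<omega> - s)\<^sup>2 \<partial>P \<theta>) = (\<integral>\<omega>. (X 1 \<omega>)\<^sup>2 \<partial>P \<theta>) - 2 * s * (\<integral>\<omega>. X 1 \<omega> \<partial>P \<theta>) + s\<^sup>2" if \<theta>: "\<theta> \<in> \<Theta>" for \<theta> s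
  proof -
    interpret prob_space "P \<theta>" using \<theta> by (rule prob_space_P)
    have eq: "(X 1 \<omega> - s)\<^sup>2 = (X 1 \<omega>)\<^sup>2 - 2 * s * X 1 \<omega> + s\<^sup>2" for \<omega> by (simp add: power2_diff algebra_simps)
    show ?thesis unfolding eq using int[OF \<theta>] sq[OF \<theta>] by (simp add: prob_space)
  qed
  have dev_le: "(\<integral>\<omega>. (X 1 \<omega> - s)\<^sup>2 \<partial>P \<theta>) \<le> S" if \<theta>: "\<theta> \<in> \<Theta>" and s: "s \<in> {\<mu>_upper, \<mu>_lower}" for \<theta> s
  proof -
    define e where "e \<theta> = (\<integral>\<omega>. X 1 \<omega> \<partial>P \<theta>)" for \<theta>
    define v where "v \<theta> = (\<integral>\<omega>. (X 1 \<omega> - e \<theta>)\<^sup>2 \<partial>P \<theta>)" for \<theta>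
    have v: "v \<theta> = (\<integral>\<omega>. (X 1 \<omega>)\<^sup>2 \<partial>P \<theta>) - (e \<theta>)\<^sup>2" if "\<theta> \<in> \<Theta>" for \<theta>
      using dev_sq[OF that, of "e \<theta>"] by (simp add: v_def e_def power2_eq_square algebra_simps)
    have "v \<theta> \<le> enn2real c" if "\<theta> \<in> \<Theta>" for \<theta>
      using v[OF that] sq_le[OF that] zero_le_power2[of "e \<theta>"] by linarith
    then have "v \<theta> \<le> \<sigma>2_upper"
      unfolding assms(9) v_def[symmetric] e_def[symmetric] by (intro cSUP_upper[OF \<theta>] bdd_aboveI2)
    \<comment> \<open>Variance plus squared bias. The mean and \<open>s\<close> both lie between the
      lower and the upper mean, so the bias is at most their distance; this is where the bracket in
      \<open>C\<^sub>0\<close> comes from.\<close>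
    moreover have "(\<integral>\<omega>. (X 1 \<omega> - s)\<^sup>2 \<partial>P \<theta>) = v \<theta> + (e \<theta> - s)\<^sup>2"
      using dev_sq[OF \<theta>, of s] v[OF \<theta>] by (simp add: e_def power2_eq_square algebra_simps)
    moreover have "(e \<theta> - s)\<^sup>2 \<le> (\<mu>_upper - \<mu>_lower)\<^sup>2"
      using mean[OF \<theta>] s by (auto simp: abs_le_square_iff[symmetric] e_def)
    ultimately show ?thesis by (simp add: S_def)
  qed
  interpret switched_iid M P \<Theta> X "deriv \<phi>" \<mu>_upper \<mu>_lower "real n" "lipschitz_constant (deriv \<phi>)" S
    using lipschitz_on_lipschitz_constant[OF assms(12)] assms(7,8) mean dev_sq dev_le
    by unfold_locales auto
  have "(\<Sum>i=1..n. X i \<omega> - \<mu> i \<omega>) / real n = W n \<omega>" for \<omega>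
    unfolding assms(14) W_def by (rule centering_eq_target(2)[OF refl])
  \<comment> \<open>There are \<open>n\<close> remainders of order \<open>1 / n\<^sup>2\<close>; the
    factor 1/2 of the Taylor bound turns \<open>S\<close> into \<open>C\<^sub>0\<close>.\<close>
  moreover have "real n * (lipschitz_constant (deriv \<phi>) / 2 * (S / (real n)\<^sup>2)) =
      C\<^sub>0 * lipschitz_constant (deriv \<phi>) / real n"
    using assms(13) by (simp add: assms(10) S_def power2_eq_square field_simps)
  ultimately show ?thesis
    using EE_expansion[OF assms(11) refl, of n] assms(13) by simp
qed

end
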